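(* Consider in $\mathbb{R}^n$ the differential equation $\dot x=f(x)$, where $f\colon\mathbb{R}^n\to\mathbb{R}^n$ is of class $C^1$, and let $p\in\mathbb{R}^n$ be an asymptotically stable equilibrium point. Then there are a neighborhood $U$ of $p$, a constant $a>0$ and a function $\mathcal L\colon U\to\mathbb{R}$ with the following properties: - $\mathcal L$ is differentiable on $U$ and of class $C^1$ on $U\setminus\{p\}$; - $\mathcal L(p)=0$ and $\mathcal L(x)>0$ for $x\neq p$; - $\dot{\mathcal L}=-a\mathcal L$ on $U$, where $\dot{\mathcal L}$ is the derivative along solutions of the equation. *)

theory Defs
  imports "HOL-Analysis.Analysis"
begin

definition C1_on :: "'a::real_normed_vector set \<Rightarrow> ('a \<Rightarrow> 'b::real_normed_vector) \<Rightarrow> bool" where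
  "C1_on S g \<longleftrightarrow> (\<exists>g' :: 'a \<Rightarrow> ('a \<Rightarrow>\<^sub>L 'b).
      (\<forall>x\<in>S. (g has_derivative blinfun_apply (g' x)) (at x)) \<and> continuous_on S g')"

definition is_solution :: "('a::real_normed_vector \<Rightarrow> 'a) \<Rightarrow> (real \<Rightarrow> 'a) \<Rightarrow> real set \<Rightarrow> bool" where
  "is_solution f x I \<longleftrightarrow> is_interval I \<and>
      (\<forall>t\<in>I. (x has_vector_derivative f (x t)) (at t within I))"

definition equilibrium :: "('a::real_normed_vector \<Rightarrow> 'a) \<Rightarrow> 'a \<Rightarrow> bool" where
  "equilibrium f p \<longleftrightarrow> f p = 0"

definition lyapunov_stable :: "('a::real_normed_vector \<Rightarrow> 'a) \<Rightarrow> 'a \<Rightarrow> bool" where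
  "lyapunov_stable f p \<longleftrightarrow> (\<forall>\<epsilon>>0. \<exists>\<delta>>0. \<forall>x0. dist x0 p < \<delta> \<longrightarrow>
      (\<exists>x. is_solution f x {0..} \<and> x 0 = x0) \<and>
      (\<forall>x. is_solution f x {0..} \<and> x 0 = x0 \<longrightarrow> (\<forall>t\<ge>0. dist (x t) p < \<epsilon>)))"

definition attractive :: "('a::real_normed_vector \<Rightarrow> 'a) \<Rightarrow> 'a \<Rightarrow> bool" where
  "attractive f p \<longleftrightarrow> (\<exists>\<eta>>0. \<forall>x0. dist x0 p < \<eta> \<longrightarrow>
      (\<exists>x. is_solution f x {0..} \<and> x 0 = x0) \<and>
      (\<forall>x. is_solution f x {0..} \<and> x 0 = x0 \<longrightarrow> (x \<longlongrightarrow> p) at_top))"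

definition asymptotically_stable_equilibrium :: "('a::real_normed_vector \<Rightarrow> 'a) \<Rightarrow> 'a \<Rightarrow> bool" where
  "asymptotically_stable_equilibrium f p \<longleftrightarrow>
      equilibrium f p \<and> lyapunov_stable f p \<and> attractive f p"

definition orbital_derivative_on :: "('a::real_normed_vector \<Rightarrow> 'a) \<Rightarrow> 'a set \<Rightarrow> ('a \<Rightarrow> real) \<Rightarrow> ('a \<Rightarrow> real) \<Rightarrow> bool" where
  "orbital_derivative_on f U L D \<longleftrightarrow> (\<forall>x I t. is_solution f x I \<and> open I \<and> t \<in> I \<and> x t \<in> U \<longrightarrow>
      ((\<lambda>s. L (x s)) has_real_derivative D (x t)) (at t))"

end

theory Submission
  imports Defs
begin

text \<open>
  Cutting \<open>f\<close> off outside a ball we obtain a field \<open>g\<close> with a complete C1 flow \<open>\<phi>\<close> that agrees with \<open>f\<close>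
  near \<open>p\<close>. Let \<open>\<psi>\<close> be a C1 function that vanishes near \<open>p\<close> and equals 1 outside a small ball in the
  basin of attraction. Every point \<open>x \<noteq> p\<close> of the basin is in the zone \<open>\<psi> = 0\<close> for all large positive
  times and, since compact subsets of the basin are attracted uniformly, in the zone \<open>\<psi> = 1\<close> for all
  large negative times. Hence \<open>T x\<close>, the integral of \<open>1 - \<psi> (\<phi> t x)\<close> over \<open>t < 0\<close> minus the integral
  of \<open>\<psi> (\<phi> t x)\<close> over \<open>t > 0\<close>, is locally an integral over a fixed bounded time interval. So \<open>T\<close> is
  C1, and \<open>T (\<phi> s x) = T x + s\<close>. Then \<open>L x = exp (- a * T x)\<close> satisfies the required equation, and if
  \<open>a\<close> is large compared with the Lipschitz constant of \<open>g\<close>, Gronwall's inequality gives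
  \<open>L x = O(|x - p|\<^sup>2)\<close>, so that \<open>L\<close> is differentiable at \<open>p\<close>.
\<close>

section \<open>Linear differential inequalities\<close>

text \<open>A Gronwall estimate for squared norms, which stay differentiable where \<open>r\<close>
  vanishes. Adding \<open>e\<^sup>2\<close> to the squared norm turns the affine differential
  inequality into a homogeneous one, because \<open>2 * n * e \<le> n\<^sup>2 + e\<^sup>2\<close>.
  With \<open>r\<close> a difference of two solutions it yields uniqueness, expansion bounds and
  remainder estimates.\<close>

lemma norm_growth_forward:
  fixes r r' :: "real \<Rightarrow> 'a::real_inner"
  assumes r: "\<And>s. s \<in> {0..t} \<Longrightarrow> (r has_vector_derivative r' s) (at s within {0..t})"
    and bound: "\<And>s. s \<in> {0..t} \<Longrightarrow> norm (r' s) \<le> K * norm (r s) + e"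
    and "0 \<le> t" "0 \<le> K" "0 \<le> e"
  shows "(norm (r t))\<^sup>2 \<le> exp ((2 * K + 1) * t) * ((norm (r 0))\<^sup>2 + e\<^sup>2)"
proof -
  define c where "c = 2 * K + 1"
  define u where "u s = exp (- c * s) * (r s \<bullet> r s + e\<^sup>2)" for s
  have "u t \<le> u 0"
  proof (rule DERIV_nonpos_imp_decreasing_open[OF \<open>0 \<le> t\<close>])
    fix s assume s: "0 < s" "s < t"
    then have "(r has_vector_derivative r' s) (at s)"
      using r[of s] by (simp add: at_within_Icc_at)
    then have rd: "(r has_derivative (\<lambda>h. h *\<^sub>R r' s)) (at s)"
      by (simp add: has_vector_derivative_def)
    define y where "y = exp (- c * s) * (2 * (r s \<bullet> r' s) - c * (r s \<bullet> r s + e\<^sup>2))"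
    have "(u has_derivative (\<lambda>h. h * y)) (at s)"
      unfolding u_def y_def
      by (rule derivative_eq_intros rd refl)+ (auto simp: algebra_simps inner_commute)
    then have "DERIV u s :> y"
      by (simp add: has_field_derivative_def mult_commute_abs)
    moreover have "y \<le> 0"
    proof -
      define n where "n = norm (r s)"
      have "r s \<bullet> r' s \<le> n * norm (r' s)"
        unfolding n_def by (rule norm_cauchy_schwarz)
      also have "\<dots> \<le> n * (K * n + e)"
        using bound[of s] s by (intro mult_left_mono) (auto simp: n_def)
      finally have "2 * (r s \<bullet> r' s) \<le> 2 * K * n\<^sup>2 + 2 * n * e"
        by (simp add: algebra_simps power2_eq_square)
      also have "2 * n * e \<le> n\<^sup>2 + e\<^sup>2"
        using zero_le_power2[of "n - e"] by (simp add: power2_eq_square algebra_simps)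
      also have "2 * K * n\<^sup>2 + (n\<^sup>2 + e\<^sup>2) \<le> c * (n\<^sup>2 + e\<^sup>2)"
        using \<open>0 \<le> K\<close> by (simp add: c_def algebra_simps)
      finally show ?thesis
        by (simp add: y_def n_def mult_le_0_iff power2_norm_eq_inner)
    qed
    ultimately show "\<exists>y. DERIV u s :> y \<and> y \<le> 0" by blast
  next
    have "continuous_on {0..t} r"
      using r has_vector_derivative_continuous continuous_on_eq_continuous_within by blast
    then show "continuous_on {0..t} u"
      unfolding u_def by (intro continuous_intros)
  qed
  then have "exp (c * t) * u t \<le> exp (c * t) * u 0"
    by simp
  then have "r t \<bullet> r t + e\<^sup>2 \<le> exp (c * t) * (r 0 \<bullet> r 0 + e\<^sup>2)"
    by (simp add: u_def mult.assoc[symmetric] exp_add[symmetric])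
  then show ?thesis
    by (simp add: c_def power2_norm_eq_inner) (smt (verit) zero_le_power2)
qed

lemma has_vector_derivative_reflect:
  assumes "(x has_vector_derivative v) (at (- s))"
  shows "((\<lambda>s. x (- s)) has_vector_derivative - v) (at s)"
proof -
  have "((\<lambda>s. - s) has_vector_derivative - 1) (at s)"
    by (auto intro!: derivative_eq_intros)
  from vector_diff_chain_at[OF this assms] show ?thesis
    by (simp add: o_def)
qed

lemma norm_growth:
  fixes r r' :: "real \<Rightarrow> 'a::real_inner"
  assumes r: "\<And>s. \<bar>s\<bar> \<le> \<bar>t\<bar> \<Longrightarrow> (r has_vector_derivative r' s) (at s)"
    and bound: "\<And>s. \<bar>s\<bar> \<le> \<bar>t\<bar> \<Longrightarrow> norm (r' s) \<le> K * norm (r s) + e"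
    and "0 \<le> K" "0 \<le> e"
  shows "(norm (r t))\<^sup>2 \<le> exp ((2 * K + 1) * \<bar>t\<bar>) * ((norm (r 0))\<^sup>2 + e\<^sup>2)"
proof (cases "0 \<le> t")
  case True
  then show ?thesis
    using norm_growth_forward[of t r r' K e, OF has_vector_derivative_at_within[OF r] bound] assms by auto
next
  case False
  have "(norm (r (- (- t))))\<^sup>2 \<le> exp ((2 * K + 1) * (- t)) * ((norm (r (- 0)))\<^sup>2 + e\<^sup>2)"
  proof (rule norm_growth_forward[of "- t" "\<lambda>s. r (- s)" "\<lambda>s. - r' (- s)" K e])
    show "((\<lambda>s. r (- s)) has_vector_derivative - r' (- s)) (at s within {0..- t})"
      if "s \<in> {0..- t}" for s
      using that by (auto intro: has_vector_derivative_at_within[OF has_vector_derivative_reflect[OF r]])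
    show "norm (- r' (- s)) \<le> K * norm (r (- s)) + e" if "s \<in> {0..- t}" for s
      using that bound[of "- s"] by auto
  qed (use False assms in auto)
  then show ?thesis using False by simp
qed

section \<open>Global solutions of Lipschitz equations\<close>

lemma continuous_primitive:
  fixes g :: "real \<Rightarrow> 'a::banach"
  assumes g: "continuous_on UNIV g"
  shows "\<exists>J. J 0 = 0 \<and> (\<forall>t. (J has_vector_derivative g t) (at t))"
proof -
  \<comment> \<open>For either sign of \<open>t\<close> one of the two integrals is over an empty or
    degenerate interval and contributes 0, so \<open>J\<close> is the oriented integral from
    0.\<close>
  define J where "J t = integral {0..t} g - integral {t..0} g" for t
  have int: "g integrable_on {a..b}" for a b
    using g by (intro integrable_continuous_real continuous_on_subset[OF g]) auto
  \<comment> \<open>On a bounded window \<open>J\<close> differs by a constant from an integral with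
    a fixed lower end, to which the fundamental theorem of calculus applies.\<close>
  have J: "J u = integral {- m..u} g - integral {- m..0} g" if "\<bar>u\<bar> \<le> m" for u m
  proof (cases "0 \<le> u")
    case True
    then have "integral {- m..0} g + integral {0..u} g = integral {- m..u} g"
      using that by (intro Henstock_Kurzweil_Integration.integral_combine int) auto
    moreover have "integral {u..0} g = 0" using True by (cases "u = 0") auto
    ultimately show ?thesis by (simp add: J_def algebra_simps)
  next
    case False
    then have "integral {- m..u} g + integral {u..0} g = integral {- m..0} g"
      using that by (intro Henstock_Kurzweil_Integration.integral_combine int) auto
    then show ?thesis using False by (simp add: J_def algebra_simps)
  qed
  have "(J has_vector_derivative g t) (at t)" for t
  proof -
    define m where "m = \<bar>t\<bar> + 1"
    have m: "- m < t" "t < m" by (auto simp: m_def)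
    have "((\<lambda>u. integral {- m..u} g) has_vector_derivative g t) (at t within {- m..m})"
      using m by (intro integral_has_vector_derivative continuous_on_subset[OF g]) auto
    then have "((\<lambda>u. integral {- m..u} g - integral {- m..0} g) has_vector_derivative g t) (at t)"
      using m by (auto simp: at_within_Icc_at intro!: derivative_eq_intros)
    then show ?thesis
      by (rule has_vector_derivative_transform_within_open[of _ _ _ "{- m<..<m}"])
        (use m J[of _ m] in \<open>auto simp: abs_le_iff\<close>)
  qed
  moreover have "J 0 = 0" by (simp add: J_def)
  ultimately show ?thesis by blast
qed

text \<open>Integrating the weight \<open>exp (c * \<bar>t\<bar>)\<close> gains a factor
  \<open>1 / c\<close>. This factor later makes the Picard operator a contraction with constant
  \<open>K / c\<close>.\<close>

lemma primitive_exp_bound: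
  fixes J g :: "real \<Rightarrow> 'a::banach"
  assumes J: "\<And>t. (J has_vector_derivative g t) (at t)" "J 0 = 0"
    and g: "\<And>t. norm (g t) \<le> M * exp (c * \<bar>t\<bar>)" and "0 < c"
  shows "norm (J t) \<le> M / c * exp (c * \<bar>t\<bar>)"
proof -
  have M: "0 \<le> M"
    using order_trans[OF norm_ge_zero g[of 0]] by simp
  have *: "norm (I t) \<le> M / c * exp (c * t)"
    if I: "\<And>t. (I has_vector_derivative h t) (at t)" "I 0 = 0"
      and h: "\<And>t. norm (h t) \<le> M * exp (c * \<bar>t\<bar>)" and t: "0 < t"
    for I h :: "real \<Rightarrow> 'a" and t
  proof -
    have "norm (I t - I 0) \<le> M / c * exp (c * t) - M / c * exp (c * 0)"
    proof (rule differentiable_bound_general[OF t])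
      show "continuous_on {0..t} I"
        using I(1) has_vector_derivative_continuous
        by (meson continuous_at_imp_continuous_on)
      show "continuous_on {0..t} (\<lambda>s. M / c * exp (c * s))"
        by (intro continuous_intros)
      show "((\<lambda>s. M / c * exp (c * s)) has_vector_derivative M * exp (c * s)) (at s)" for s
        unfolding has_real_derivative_iff_has_vector_derivative[symmetric]
        using \<open>0 < c\<close> by (auto intro!: derivative_eq_intros)
      show "norm (h s) \<le> M * exp (c * s)" if "0 < s" for s
        using h[of s] that by simp
    qed (use I in auto)
    then show ?thesis
      using I(2) M \<open>0 < c\<close> by (smt (verit) divide_nonneg_nonneg exp_ge_zero mult_nonneg_nonneg diff_zero)
  qed
  consider "t = 0" | "0 < t" | "t < 0" by linarith
  then show ?thesis
  proof cases
    case 1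
    then show ?thesis using J(2) M \<open>0 < c\<close> by simp
  next
    case 2
    then show ?thesis using *[OF J g] by simp
  next
    case 3
    have "norm (J (- (- t))) \<le> M / c * exp (c * (- t))"
    proof (rule *)
      show "((\<lambda>s. J (- s)) has_vector_derivative - g (- s)) (at s)" for s
        by (rule has_vector_derivative_reflect[OF J(1)])
      show "norm (- g (- s)) \<le> M * exp (c * \<bar>s\<bar>)" for s
        using g[of "- s"] by simp
    qed (use 3 J in auto)
    then show ?thesis using 3 by simp
  qed
qed

text \<open>In the norm weighted by \<open>exp (- c * \<bar>t\<bar>)\<close>, with \<open>c = 2 * K + 1\<close>, the Picard operator is a
  contraction on the whole time axis at once.\<close>

theorem global_solution_exists:
  fixes F :: "real \<Rightarrow> 'a::banach \<Rightarrow> 'a"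
  assumes cont: "continuous_on UNIV (\<lambda>(t, x). F t x)"
    and lip: "\<And>t x y. norm (F t x - F t y) \<le> K * norm (x - y)"
    and bound: "\<And>t. norm (F t 0) \<le> B" and "0 \<le> K"
  shows "\<exists>x. x 0 = x0 \<and> (\<forall>t. (x has_vector_derivative F t (x t)) (at t))"
proof -
  define c where "c = 2 * K + 1"
  have c: "0 < c" "K / c < 1" "0 \<le> K / c" using \<open>0 \<le> K\<close> by (auto simp: c_def)
  \<comment> \<open>A bounded continuous \<open>u\<close> encodes the candidate solution
    \<open>exp (c * \<bar>t\<bar>) *\<^sub>R u t\<close>, so the sup norm of \<open>u\<close> is the
    weighted norm of the candidate; \<open>P\<close> below is the Picard operator in this
    encoding.\<close>
  define g where "g u t = F t (exp (c * \<bar>t\<bar>) *\<^sub>R apply_bcontfun u t)" for u t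
  have contg: "continuous_on UNIV (g u)" for u
  proof -
    have "continuous_on UNIV (\<lambda>t. (t, exp (c * \<bar>t\<bar>) *\<^sub>R apply_bcontfun u t))"
      by (intro continuous_intros) auto
    from continuous_on_compose2[OF cont this] show ?thesis
      by (simp add: g_def[abs_def])
  qed
  define J where "J u = (SOME J. J 0 = 0 \<and> (\<forall>t. (J has_vector_derivative g u t) (at t)))" for u
  have J: "J u 0 = 0" "(J u has_vector_derivative g u t) (at t)" for u t
    using someI_ex[OF continuous_primitive[OF contg[of u]]] by (auto simp: J_def)
  have B: "0 \<le> B" using order_trans[OF norm_ge_zero bound[of 0]] .
  define P where "P u t = exp (- c * \<bar>t\<bar>) *\<^sub>R (x0 + J u t)" for u t
  have "P u \<in> bcontfun" for u
  proof (rule bcontfun_normI)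
    have "continuous_on UNIV (J u)"
      using J(2) has_vector_derivative_continuous
      by (meson continuous_at_imp_continuous_on)
    then show "continuous_on UNIV (P u)"
      unfolding P_def[abs_def] by (intro continuous_intros)
    fix t
    have "norm (J u t) \<le> (B + K * norm u) / c * exp (c * \<bar>t\<bar>)"
    proof (rule primitive_exp_bound[OF J(2) J(1) _ c(1)])
      fix s
      have "norm (g u s) \<le> norm (F s 0) + norm (g u s - F s 0)"
        by norm
      also have "\<dots> \<le> B + K * norm (exp (c * \<bar>s\<bar>) *\<^sub>R apply_bcontfun u s)"
        using lip[of s "exp (c * \<bar>s\<bar>) *\<^sub>R apply_bcontfun u s" 0] bound[of s]
        by (auto simp: g_def intro!: add_mono)
      also have "\<dots> \<le> B * exp (c * \<bar>s\<bar>) + K * (exp (c * \<bar>s\<bar>) * norm u)"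
        using B \<open>0 \<le> K\<close> c by (intro add_mono mult_left_mono)
          (auto simp: mult_le_cancel_left1 intro!: norm_bounded mult_left_mono)
      finally show "norm (g u s) \<le> (B + K * norm u) * exp (c * \<bar>s\<bar>)"
        by (simp add: algebra_simps)
    qed
    then have "exp (- c * \<bar>t\<bar>) * norm (J u t)
        \<le> exp (- c * \<bar>t\<bar>) * ((B + K * norm u) / c * exp (c * \<bar>t\<bar>))"
      by (intro mult_left_mono) auto
    also have "\<dots> = (B + K * norm u) / c"
      by (simp add: exp_minus)
    finally have 1: "exp (- c * \<bar>t\<bar>) * norm (J u t) \<le> (B + K * norm u) / c" .
    have 2: "exp (- c * \<bar>t\<bar>) * norm x0 \<le> norm x0"
      using c by (intro mult_left_le_one_le) auto
    have "norm (P u t) \<le> exp (- c * \<bar>t\<bar>) * (norm x0 + norm (J u t))"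
      unfolding P_def by (auto intro!: mult_left_mono norm_triangle_ineq)
    then show "norm (P u t) \<le> norm x0 + (B + K * norm u) / c"
      using 1 2 by (simp add: distrib_left)
  qed
  then have P: "apply_bcontfun (Bcontfun (P u)) = P u" for u
    by (rule Bcontfun_inverse)
  have "dist (Bcontfun (P u)) (Bcontfun (P v)) \<le> K / c * dist u v" for u v
  proof (rule dist_bound)
    fix t
    have "norm (J u t - J v t) \<le> (K * dist u v) / c * exp (c * \<bar>t\<bar>)"
    proof (rule primitive_exp_bound[OF _ _ _ c(1)])
      show "((\<lambda>t. J u t - J v t) has_vector_derivative g u t - g v t) (at t)" for t
        by (intro derivative_intros J)
      fix s
      have "norm (g u s - g v s) \<le> K * norm (exp (c * \<bar>s\<bar>) *\<^sub>R (apply_bcontfun u s - apply_bcontfun v s))"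
        using lip by (simp add: g_def scaleR_diff_right)
      also have "\<dots> \<le> K * (exp (c * \<bar>s\<bar>) * dist u v)"
        using \<open>0 \<le> K\<close> dist_bounded[of u s v]
        by (intro mult_left_mono) (auto simp: dist_norm)
      finally show "norm (g u s - g v s) \<le> K * dist u v * exp (c * \<bar>s\<bar>)"
        by (simp add: algebra_simps)
    qed (simp add: J)
    then have "exp (- c * \<bar>t\<bar>) * norm (J u t - J v t)
        \<le> exp (- c * \<bar>t\<bar>) * ((K * dist u v) / c * exp (c * \<bar>t\<bar>))"
      by (intro mult_left_mono) auto
    also have "\<dots> = K / c * dist u v"
      by (simp add: exp_minus)
    finally show "dist (apply_bcontfun (Bcontfun (P u)) t) (apply_bcontfun (Bcontfun (P v)) t)
        \<le> K / c * dist u v"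
      by (simp add: P P_def dist_norm scaleR_diff_right[symmetric])
  qed
  then obtain u where "Bcontfun (P u) = u"
    using banach_fix_type[OF c(3,2), of "\<lambda>u. Bcontfun (P u)"] by blast
  then have u: "apply_bcontfun u t = P u t" for t
    using P by metis
  have "(\<lambda>t. x0 + J u t) 0 = x0" using J by simp
  moreover have "((\<lambda>t. x0 + J u t) has_vector_derivative F t (x0 + J u t)) (at t)" for t
  proof -
    have "exp (c * \<bar>t\<bar>) *\<^sub>R apply_bcontfun u t = x0 + J u t"
      by (simp add: u P_def exp_minus)
    then have "g u t = F t (x0 + J u t)" by (simp add: g_def)
    then show ?thesis using J(2)[of u t] by (auto intro!: derivative_eq_intros)
  qed
  ultimately show ?thesis by (intro exI[of _ "\<lambda>t. x0 + J u t"]) auto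
qed

section \<open>The flow of a vector field with bounded continuous derivative\<close>

text \<open>The point \<open>z\<close> may lie outside \<open>C\<close>, since a perturbed
  trajectory leaves the reference orbit segment. Enlarging \<open>C\<close> to a ball of radius
  \<open>R + 1\<close> and taking \<open>d \<le> 1\<close> keeps both points in one compact
  set.\<close>

lemma uniformly_continuous_near_bounded:
  fixes g :: "'a::euclidean_space \<Rightarrow> 'b::metric_space"
  assumes "continuous_on UNIV g" "bounded C" "0 < e"
  shows "\<exists>d>0. \<forall>y\<in>C. \<forall>z. dist z y < d \<longrightarrow> dist (g z) (g y) < e"
proof -
  obtain R where R: "C \<subseteq> cball 0 R"
    using \<open>bounded C\<close> unfolding bounded_iff by (auto simp: subset_iff)
  have "uniformly_continuous_on (cball 0 (R + 1)) g"
    using assms by (intro compact_uniformly_continuous continuous_on_subset[OF assms(1)]) auto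
  then obtain d where "0 < d"
    and d: "\<And>y z. y \<in> cball 0 (R + 1) \<Longrightarrow> z \<in> cball 0 (R + 1) \<Longrightarrow> dist z y < d \<Longrightarrow> dist (g z) (g y) < e"
    unfolding uniformly_continuous_on_def using \<open>0 < e\<close> by metis
  have "dist (g z) (g y) < e" if "y \<in> C" "dist z y < min d 1" for y z
  proof (rule d)
    have "norm y \<le> R" using R that by auto
    moreover have "norm (z - y) < 1" using that by (auto simp: dist_norm)
    ultimately show "y \<in> cball 0 (R + 1)" "z \<in> cball 0 (R + 1)"
      using norm_triangle_sub[of z y] by auto
  qed (use that in auto)
  then show ?thesis using \<open>0 < d\<close> by (intro exI[of _ "min d 1"]) auto
qed

locale bounded_C1_field =
  fixes F :: "'a::euclidean_space \<Rightarrow> 'a" and F' :: "'a \<Rightarrow> 'a \<Rightarrow>\<^sub>L 'a" and K :: real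
  assumes F: "\<And>x. (F has_derivative blinfun_apply (F' x)) (at x)"
    and F'_cont: "continuous_on UNIV F'"
    and F'_bound: "\<And>x. norm (F' x) \<le> K"
begin

lemma K_nonneg: "0 \<le> K"
  using order_trans[OF norm_ge_zero F'_bound] .

lemma F'_apply_bound: "norm (F' x h) \<le> K * norm h"
  by (meson F'_bound norm_blinfun mult_right_mono norm_ge_zero order_trans)

lemma F_lipschitz: "norm (F x - F y) \<le> K * norm (x - y)"
  by (rule differentiable_bound[of UNIV F "\<lambda>x. blinfun_apply (F' x)"])
    (auto simp: F norm_blinfun.rep_eq[symmetric] F'_bound)

lemma continuous_F: "continuous_on S F"
  using F has_derivative_continuous by (blast intro: continuous_at_imp_continuous_on)

definition flow :: "real \<Rightarrow> 'a \<Rightarrow> 'a" where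
  "flow t x = (SOME y. y 0 = x \<and> (\<forall>t. (y has_vector_derivative F (y t)) (at t))) t"

lemma flow_0 [simp]: "flow 0 x = x"
  and flow_deriv: "((\<lambda>t. flow t x) has_vector_derivative F (flow t x)) (at t)"
proof -
  have "continuous_on UNIV (\<lambda>z. F (snd z))"
    by (rule continuous_on_compose2[OF continuous_F[of UNIV]]) (auto intro!: continuous_intros)
  then have "\<exists>y. y 0 = x \<and> (\<forall>t. (y has_vector_derivative F (y t)) (at t))"
    by (intro global_solution_exists[of "\<lambda>_. F" K "norm (F 0)"])
      (auto simp: case_prod_unfold F_lipschitz K_nonneg)
  from someI_ex[OF this] show "flow 0 x = x" "((\<lambda>t. flow t x) has_vector_derivative F (flow t x)) (at t)"
    by (auto simp: flow_def)
qed

lemma continuous_flow_time: "continuous_on S (\<lambda>t. flow t x)"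
  using flow_deriv has_vector_derivative_continuous by (blast intro: continuous_at_imp_continuous_on)

lemma flow_unique:
  assumes "\<And>s. \<bar>s\<bar> \<le> \<bar>t\<bar> \<Longrightarrow> (y has_vector_derivative F (y s)) (at s)"
  shows "y t = flow t (y 0)"
proof -
  have "(norm (y t - flow t (y 0)))\<^sup>2 \<le> exp ((2 * K + 1) * \<bar>t\<bar>) * ((norm (y 0 - flow 0 (y 0)))\<^sup>2 + 0\<^sup>2)"
    by (rule norm_growth[where r' = "\<lambda>s. F (y s) - F (flow s (y 0))"])
      (auto intro!: derivative_eq_intros assms flow_deriv simp: F_lipschitz K_nonneg)
  then show ?thesis by simp
qed

lemma flow_add: "flow (s + t) x = flow s (flow t x)"
proof -
  have "((\<lambda>s. flow (s + t) x) has_vector_derivative F (flow (s + t) x)) (at s)" for s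
  proof -
    have "((\<lambda>s. s + t) has_vector_derivative 1) (at s)"
      by (auto intro!: derivative_eq_intros)
    from vector_diff_chain_at[OF this flow_deriv] show ?thesis by (simp add: o_def)
  qed
  from flow_unique[OF this, of s] show ?thesis by simp
qed

text \<open>The rate \<open>K + 1/2\<close> is half the rate of the estimate for the squared norm;
  it is the origin of the constant \<open>2 * K + 1\<close> in \<open>lyap\<close>.\<close>

lemma flow_expansion: "norm (flow t x - flow t y) \<le> exp ((2 * K + 1) * \<bar>t\<bar> / 2) * norm (x - y)"
proof -
  have "(norm (flow t x - flow t y))\<^sup>2 \<le> exp ((2 * K + 1) * \<bar>t\<bar>) * ((norm (flow 0 x - flow 0 y))\<^sup>2 + 0\<^sup>2)"
    by (rule norm_growth[where r' = "\<lambda>s. F (flow s x) - F (flow s y)"])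
      (auto intro!: derivative_eq_intros flow_deriv simp: F_lipschitz K_nonneg)
  also have "\<dots> = (exp ((2 * K + 1) * \<bar>t\<bar> / 2) * norm (x - y))\<^sup>2"
    by (simp add: power_mult_distrib exp_double[symmetric])
  finally show ?thesis
    by (rule power2_le_imp_le) auto
qed

lemma flow_uniformly_close:
  assumes "0 < d"
  shows "\<exists>\<delta>>0. \<forall>h. norm h < \<delta> \<longrightarrow> (\<forall>s. \<bar>s\<bar> \<le> \<bar>t\<bar> \<longrightarrow> norm (flow s (x + h) - flow s x) < d)"
proof -
  define M where "M = exp ((2 * K + 1) * \<bar>t\<bar> / 2)"
  have "norm (flow s (x + h) - flow s x) < d" if "norm h < d / M" "\<bar>s\<bar> \<le> \<bar>t\<bar>" for h s
  proof -
    have "norm (flow s (x + h) - flow s x) \<le> exp ((2 * K + 1) * \<bar>s\<bar> / 2) * norm h"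
      using flow_expansion[of s "x + h" x] by simp
    also have "\<dots> \<le> M * norm h"
      using that K_nonneg by (intro mult_right_mono) (auto simp: M_def intro!: mult_left_mono)
    also have "\<dots> < d" using that by (simp add: M_def field_simps)
    finally show ?thesis .
  qed
  then show ?thesis using assms by (intro exI[of _ "d / M"]) (auto simp: M_def)
qed

lemma flow_bounded: "bounded ((\<lambda>s. flow s x) ` {- \<bar>t\<bar>..\<bar>t\<bar>})"
  by (intro compact_imp_bounded compact_continuous_image continuous_flow_time) auto

section \<open>The variational equation and differentiability in the initial point\<close>

definition variation :: "'a \<Rightarrow> 'a \<Rightarrow> real \<Rightarrow> 'a" where
  "variation x h = (SOME z. z 0 = h \<and> (\<forall>t. (z has_vector_derivative F' (flow t x) (z t)) (at t)))"

lemma variation_0 [simp]: "variation x h 0 = h"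
  and variation_deriv: "(variation x h has_vector_derivative F' (flow t x) (variation x h t)) (at t)"
proof -
  have "continuous_on UNIV (\<lambda>z :: real \<times> 'a. F' (flow (fst z) x))"
    by (rule continuous_on_compose2[OF F'_cont], rule continuous_on_compose2[OF continuous_flow_time[of UNIV]])
      (auto intro!: continuous_intros)
  then have "continuous_on UNIV (\<lambda>z :: real \<times> 'a. F' (flow (fst z) x) (snd z))"
    by (intro continuous_intros)
  then have "\<exists>z. z 0 = h \<and> (\<forall>t. (z has_vector_derivative F' (flow t x) (z t)) (at t))"
    by (intro global_solution_exists[of "\<lambda>t z. F' (flow t x) z" K 0])
      (auto simp: case_prod_unfold K_nonneg F'_apply_bound blinfun.diff_right[symmetric])
  from someI_ex[OF this] show "variation x h 0 = h"
    "(variation x h has_vector_derivative F' (flow t x) (variation x h t)) (at t)"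
    by (auto simp: variation_def)
qed

lemma variation_unique:
  assumes "\<And>s. (z has_vector_derivative F' (flow s x) (z s)) (at s)"
  shows "z t = variation x (z 0) t"
proof -
  have "(norm (z t - variation x (z 0) t))\<^sup>2
      \<le> exp ((2 * K + 1) * \<bar>t\<bar>) * ((norm (z 0 - variation x (z 0) 0))\<^sup>2 + 0\<^sup>2)"
    by (rule norm_growth[where r' = "\<lambda>s. F' (flow s x) (z s) - F' (flow s x) (variation x (z 0) s)"])
      (auto intro!: derivative_eq_intros assms variation_deriv
        simp: F'_apply_bound K_nonneg blinfun.diff_right[symmetric])
  then show ?thesis by simp
qed

lemma variation_bound: "norm (variation x h t) \<le> exp ((2 * K + 1) * \<bar>t\<bar> / 2) * norm h"
proof -
  have "(norm (variation x h t))\<^sup>2 \<le> exp ((2 * K + 1) * \<bar>t\<bar>) * ((norm (variation x h 0))\<^sup>2 + 0\<^sup>2)"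
    by (rule norm_growth[where r' = "\<lambda>s. F' (flow s x) (variation x h s)"])
      (auto intro!: variation_deriv simp: F'_apply_bound K_nonneg)
  also have "\<dots> = (exp ((2 * K + 1) * \<bar>t\<bar> / 2) * norm h)\<^sup>2"
    by (simp add: power_mult_distrib exp_double[symmetric])
  finally show ?thesis
    by (rule power2_le_imp_le) auto
qed

text \<open>Sums and multiples of solutions of the linearised equation are solutions, so linearity
  in \<open>h\<close> follows from uniqueness.\<close>

lemma bounded_linear_variation: "bounded_linear (\<lambda>h. variation x h t)"
proof (rule bounded_linear_intro)
  fix h k :: 'a and c :: real
  have "(\<lambda>t. variation x h t + variation x k t) t = variation x (variation x h 0 + variation x k 0) t"
    by (rule variation_unique)
      (auto intro!: derivative_eq_intros variation_deriv simp: blinfun.add_right)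
  then show "variation x (h + k) t = variation x h t + variation x k t" by simp
  have "(\<lambda>t. c *\<^sub>R variation x h t) t = variation x (c *\<^sub>R variation x h 0) t"
    by (rule variation_unique)
      (auto intro!: derivative_eq_intros variation_deriv simp: blinfun.scaleR_right)
  then show "variation x (c *\<^sub>R h) t = c *\<^sub>R variation x h t" by simp
  show "norm (variation x h t) \<le> norm h * exp ((2 * K + 1) * \<bar>t\<bar> / 2)"
    using variation_bound by (simp add: mult.commute)
qed

text \<open>The mean value inequality on a ball on which \<open>F'\<close> varies by at most
  \<open>e\<close>; the radius is the same for all \<open>y\<close> in \<open>C\<close> by uniform
  continuity near bounded sets.\<close>

lemma F_linearization:
  assumes "bounded C" "0 < e"
  shows "\<exists>d>0. \<forall>y\<in>C. \<forall>w. norm w < d \<longrightarrow> norm (F (y + w) - F y - F' y w) \<le> e * norm w"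
proof -
  obtain d where "0 < d" and d: "\<And>y z. y \<in> C \<Longrightarrow> dist z y < d \<Longrightarrow> dist (F' z) (F' y) < e"
    using uniformly_continuous_near_bounded[OF F'_cont assms] by blast
  have "norm (F (y + w) - F y - F' y w) \<le> e * norm w" if "y \<in> C" "norm w < d" for y w
  proof -
    have "norm (F (y + w) - F y - F' y (y + w - y)) \<le> norm (y + w - y) * e"
    proof (rule differentiable_bound_linearization[where S = "ball y d" and f' = "\<lambda>x. blinfun_apply (F' x)"])
      show "y + t *\<^sub>R (y + w - y) \<in> ball y d" if "t \<in> {0..1}" for t
      proof -
        have "\<bar>t\<bar> * norm w \<le> norm w"
          using that by (intro mult_left_le_one_le) auto
        then show ?thesis using \<open>norm w < d\<close> by (auto simp: dist_norm)
      qed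
      show "onorm (blinfun_apply (F' z) - blinfun_apply (F' y)) \<le> e" if "z \<in> ball y d" for z
      proof -
        have "blinfun_apply (F' z) - blinfun_apply (F' y) = blinfun_apply (F' z - F' y)"
          by (auto simp: blinfun.diff_left)
        then show ?thesis
          using d[OF \<open>y \<in> C\<close>, of z] that
          by (simp add: norm_blinfun.rep_eq[symmetric] dist_norm norm_minus_commute)
      qed
    qed (use \<open>0 < d\<close> in \<open>auto intro: has_derivative_at_withinI[OF F]\<close>)
    then show ?thesis by (simp add: mult.commute)
  qed
  then show ?thesis using \<open>0 < d\<close> by blast
qed

text \<open>The remainder \<open>r\<close> starts at 0 and solves the variational equation up to the
  Taylor error of \<open>F\<close> along the orbit of \<open>x\<close>. That error is small relative
  to \<open>norm h\<close>, and Gronwall passes this on to \<open>r t\<close>.\<close>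

lemma flow_has_derivative: "(flow t has_derivative (\<lambda>h. variation x h t)) (at x)"
  unfolding has_derivative_at_alt
proof (intro conjI bounded_linear_variation allI impI)
  fix e :: real assume "0 < e"
  define M where "M = exp ((2 * K + 1) * \<bar>t\<bar> / 2)"
  have "0 < M" by (simp add: M_def)
  \<comment> \<open>One factor \<open>M\<close> arises from the expansion of the flow, which bounds
    \<open>w\<close>, and one from Gronwall's inequality.\<close>
  define e' where "e' = e / M\<^sup>2"
  have "0 < e'" using \<open>0 < e\<close> \<open>0 < M\<close> by (simp add: e'_def)
  obtain d where "0 < d" and d: "\<And>s w. \<bar>s\<bar> \<le> \<bar>t\<bar> \<Longrightarrow> norm w < d \<Longrightarrow>
      norm (F (flow s x + w) - F (flow s x) - F' (flow s x) w) \<le> e' * norm w"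
    using F_linearization[OF flow_bounded[of x t] \<open>0 < e'\<close>] by (auto simp: abs_le_iff)
  obtain \<delta> where "0 < \<delta>"
    and \<delta>: "\<And>h s. norm h < \<delta> \<Longrightarrow> \<bar>s\<bar> \<le> \<bar>t\<bar> \<Longrightarrow> norm (flow s (x + h) - flow s x) < d"
    using flow_uniformly_close[OF \<open>0 < d\<close>, of t x] by blast
  have *: "norm (flow t (x + h) - flow t x - variation x h t) \<le> e * norm h" if h: "norm h < \<delta>" for h
  proof -
    define r where "r s = flow s (x + h) - flow s x - variation x h s" for s
    define r' where "r' s = F (flow s (x + h)) - F (flow s x) - F' (flow s x) (variation x h s)" for s
    have "(norm (r t))\<^sup>2 \<le> exp ((2 * K + 1) * \<bar>t\<bar>) * ((norm (r 0))\<^sup>2 + (e' * M * norm h)\<^sup>2)"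
    proof (rule norm_growth)
      show "(r has_vector_derivative r' s) (at s)" for s
        unfolding r_def r'_def by (intro derivative_intros flow_deriv variation_deriv)
      show "norm (r' s) \<le> K * norm (r s) + e' * M * norm h" if s: "\<bar>s\<bar> \<le> \<bar>t\<bar>" for s
      proof -
        define w where "w = flow s (x + h) - flow s x"
        have "r' s = F' (flow s x) (r s) + (F (flow s x + w) - F (flow s x) - F' (flow s x) w)"
          by (simp add: r_def r'_def w_def blinfun.diff_right blinfun.add_right algebra_simps)
        then have "norm (r' s) \<le> K * norm (r s) + e' * norm w"
          using d[OF s, of w] \<delta>[OF h s] F'_apply_bound[of "flow s x" "r s"]
          by (smt (verit) norm_triangle_ineq w_def)
        moreover have "norm w \<le> exp ((2 * K + 1) * \<bar>s\<bar> / 2) * norm h"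
          using flow_expansion[of s "x + h" x] by (simp add: w_def)
        moreover have "\<dots> \<le> M * norm h"
          using s K_nonneg by (intro mult_right_mono) (auto simp: M_def intro!: mult_left_mono)
        ultimately show ?thesis
          using \<open>0 < e'\<close> by (smt (verit) mult.assoc mult_left_mono)
      qed
    qed (use K_nonneg \<open>0 < e'\<close> \<open>0 < M\<close> in auto)
    also have "\<dots> = (M * (e' * M * norm h))\<^sup>2"
      by (simp add: r_def M_def power_mult_distrib exp_double[symmetric])
    also have "M * (e' * M * norm h) = e * norm h"
      using \<open>0 < M\<close> by (simp add: e'_def power2_eq_square)
    finally have "norm (r t) \<le> e * norm h"
      using \<open>0 < e\<close> by (auto intro: power2_le_imp_le)
    then show ?thesis by (simp add: r_def)
  qed
  have "norm (flow t y - flow t x - variation x (y - x) t) \<le> e * norm (y - x)"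
    if "norm (y - x) < \<delta>" for y
    using *[OF that] by simp
  then show "\<exists>d>0. \<forall>y. norm (y - x) < d \<longrightarrow>
      norm (flow t y - flow t x - variation x (y - x) t) \<le> e * norm (y - x)"
    using \<open>0 < \<delta>\<close> by blast
qed

text \<open>The difference of the variations along two nearby orbits starts at 0 and is driven by
  the difference of \<open>F'\<close> along these orbits, which is uniformly small on the bounded
  time interval.\<close>

lemma continuous_variation: "continuous_on S (\<lambda>x. variation x h t)"
proof (rule continuous_at_imp_continuous_on, rule ballI)
  fix x
  define M where "M = exp ((2 * K + 1) * \<bar>t\<bar> / 2)"
  have "0 < M" by (simp add: M_def)
  \<comment> \<open>The summand 1 keeps \<open>B\<close> positive for \<open>h = 0\<close>, so that
    dividing by \<open>B\<close> is legitimate.\<close>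
  define B where "B = M * norm h + 1"
  have "0 < B" using \<open>0 < M\<close> by (simp add: B_def add_nonneg_pos)
  have B: "norm (variation x h s) \<le> B" if "\<bar>s\<bar> \<le> \<bar>t\<bar>" for s
  proof -
    have "exp ((2 * K + 1) * \<bar>s\<bar> / 2) * norm h \<le> M * norm h"
      using that K_nonneg by (intro mult_right_mono) (auto simp: M_def intro!: mult_left_mono)
    then show ?thesis using variation_bound[of x h s] by (simp add: B_def)
  qed
  show "isCont (\<lambda>x. variation x h t) x"
    unfolding continuous_at_eps_delta
  proof (intro allI impI)
    fix e :: real assume "0 < e"
    \<comment> \<open>\<open>B\<close> bounds the variation, \<open>M\<close> is the Gronwall
      factor, and the 2 leaves \<open>e / 2\<close>, which makes the final inequality
      strict.\<close>
    define e' where "e' = e / (2 * M * B)"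
    have "0 < e'" using \<open>0 < e\<close> \<open>0 < M\<close> \<open>0 < B\<close> by (simp add: e'_def)
    obtain d where "0 < d" and d: "\<And>s z. \<bar>s\<bar> \<le> \<bar>t\<bar> \<Longrightarrow> dist z (flow s x) < d \<Longrightarrow>
        dist (F' z) (F' (flow s x)) < e'"
      using uniformly_continuous_near_bounded[OF F'_cont flow_bounded[of x t] \<open>0 < e'\<close>]
      by (auto simp: abs_le_iff)
    obtain \<delta> where "0 < \<delta>"
      and \<delta>: "\<And>h s. norm h < \<delta> \<Longrightarrow> \<bar>s\<bar> \<le> \<bar>t\<bar> \<Longrightarrow> norm (flow s (x + h) - flow s x) < d"
      using flow_uniformly_close[OF \<open>0 < d\<close>, of t x] by blast
    have "dist (variation y h t) (variation x h t) < e" if y: "dist y x < \<delta>" for y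
    proof -
      define r where "r s = variation y h s - variation x h s" for s
      define r' where "r' s = F' (flow s y) (variation y h s) - F' (flow s x) (variation x h s)" for s
      have "(norm (r t))\<^sup>2 \<le> exp ((2 * K + 1) * \<bar>t\<bar>) * ((norm (r 0))\<^sup>2 + (e' * B)\<^sup>2)"
      proof (rule norm_growth)
        show "(r has_vector_derivative r' s) (at s)" for s
          unfolding r_def r'_def by (intro derivative_intros variation_deriv)
        show "norm (r' s) \<le> K * norm (r s) + e' * B" if s: "\<bar>s\<bar> \<le> \<bar>t\<bar>" for s
        proof -
          have "norm ((F' (flow s y) - F' (flow s x)) (variation x h s)) \<le>
              norm (F' (flow s y) - F' (flow s x)) * norm (variation x h s)"
            by (rule norm_blinfun)
          also have "\<dots> \<le> e' * B"
            using d[OF s, of "flow s y"] \<delta>[OF _ s, of "y - x"] y B[OF s] \<open>0 < e'\<close>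
            by (intro mult_mono) (auto simp: dist_norm)
          finally have "norm ((F' (flow s y) - F' (flow s x)) (variation x h s)) \<le> e' * B" .
          moreover have "r' s = F' (flow s y) (r s) + (F' (flow s y) - F' (flow s x)) (variation x h s)"
            by (simp add: r_def r'_def blinfun.diff_right blinfun.diff_left)
          ultimately show ?thesis
            using F'_apply_bound[of "flow s y" "r s"] by (smt (verit) norm_triangle_ineq)
        qed
      qed (use K_nonneg \<open>0 < e'\<close> \<open>0 < B\<close> in auto)
      also have "\<dots> = (M * (e' * B))\<^sup>2"
        by (simp add: r_def M_def power_mult_distrib exp_double[symmetric])
      also have "M * (e' * B) = e / 2"
        using \<open>0 < M\<close> \<open>0 < B\<close> by (simp add: e'_def)
      finally have "norm (r t) \<le> e / 2"
        using \<open>0 < e\<close> by (auto intro: power2_le_imp_le)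
      then show ?thesis using \<open>0 < e\<close> by (simp add: r_def dist_norm)
    qed
    then show "\<exists>d>0. \<forall>y. dist y x < d \<longrightarrow> dist (variation y h t) (variation x h t) < e"
      using \<open>0 < \<delta>\<close> by blast
  qed
qed

end

section \<open>Functions of class C1\<close>

text \<open>In finite dimension, continuity of a family of linear maps in operator norm follows from
  continuity at each fixed vector \<open>h\<close>.\<close>

lemma C1_onI:
  fixes g :: "'a::euclidean_space \<Rightarrow> 'b::real_normed_vector"
  assumes g: "\<And>x. x \<in> S \<Longrightarrow> (g has_derivative g' x) (at x)"
    and cont: "\<And>h. continuous_on S (\<lambda>x. g' x h)"
  shows "C1_on S g"
proof -
  have *: "blinfun_apply (Blinfun (g' x)) = g' x" if "x \<in> S" for x
    using g[OF that] by (intro bounded_linear_Blinfun_apply has_derivative_bounded_linear)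
  have "continuous_on S (\<lambda>x. Blinfun (g' x))"
  proof (rule continuous_on_blinfun_componentwise)
    fix h
    show "continuous_on S (\<lambda>x. blinfun_apply (Blinfun (g' x)) h)"
      using cont[of h] by (rule continuous_on_eq) (simp add: *)
  qed
  then show ?thesis
    unfolding C1_on_def using g * by (intro exI[of _ "\<lambda>x. Blinfun (g' x)"]) auto
qed

text \<open>The derivative at a point is unique, so the local derivatives all agree with
  \<open>frechet_derivative\<close> and glue to one continuous map.\<close>

lemma C1_on_local:
  fixes g :: "'a::euclidean_space \<Rightarrow> 'b::real_normed_vector"
  assumes loc: "\<And>x. x \<in> S \<Longrightarrow> \<exists>V. open V \<and> x \<in> V \<and> C1_on V g"
  shows "C1_on S g"
proof (rule C1_onI)
  fix x assume "x \<in> S"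
  then have "g differentiable (at x)"
    using loc unfolding C1_on_def differentiable_def by blast
  then show "(g has_derivative frechet_derivative g (at x)) (at x)"
    by (simp add: frechet_derivative_works[symmetric])
next
  fix h
  show "continuous_on S (\<lambda>x. frechet_derivative g (at x) h)"
  proof (rule continuous_at_imp_continuous_on, rule ballI)
    fix x assume "x \<in> S"
    then obtain V g' where V: "open V" "x \<in> V"
      and g': "\<And>y. y \<in> V \<Longrightarrow> (g has_derivative blinfun_apply (g' y)) (at y)" "continuous_on V g'"
      using loc unfolding C1_on_def by metis
    have "continuous_on V (\<lambda>y. g' y h)"
      using g'(2) by (intro continuous_intros)
    then have "continuous_on V (\<lambda>y. frechet_derivative g (at y) h)"
      by (rule continuous_on_eq) (use g'(1) frechet_derivative_at in fastforce)
    then show "isCont (\<lambda>x. frechet_derivative g (at x) h) x"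
      using V continuous_on_eq_continuous_at by blast
  qed
qed

section \<open>Cut-off functions and globally bounded derivatives\<close>

lemma smooth_step_exists:
  "\<exists>\<beta> \<beta>' :: real \<Rightarrow> real. (\<forall>u. (\<beta> has_real_derivative \<beta>' u) (at u)) \<and> continuous_on UNIV \<beta>' \<and>
     (\<forall>u\<le>0. \<beta> u = 0) \<and> (\<forall>u\<ge>1. \<beta> u = 1) \<and> (\<forall>u. 0 \<le> \<beta> u)"
proof -
  \<comment> \<open>The squared positive part is already C1, with derivative
    \<open>2 * max 0 u\<close>; \<open>q u\<close> and \<open>q (1 - u)\<close> never vanish
    together, so the quotient \<open>q u / D u\<close> is a C1 step.\<close>
  define q where "q u = (max 0 u)\<^sup>2" for u :: real
  have q: "(q has_real_derivative 2 * max 0 u) (at u)" for u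
  proof -
    consider "u < 0" | "u = 0" | "0 < u" by linarith
    then show ?thesis
    proof cases
      case 1
      have "((\<lambda>_. 0) has_real_derivative 0) (at u)" by simp
      then have "(q has_real_derivative 0) (at u)"
        by (rule has_field_derivative_transform_within_open[of _ _ _ "{..<0}"]) (use 1 in \<open>auto simp: q_def\<close>)
      then show ?thesis using 1 by simp
    next
      case 2
      have "((\<lambda>h. (q h - q 0) / h) \<longlongrightarrow> 0) (at 0)"
      proof (rule Lim_null_comparison)
        show "\<forall>\<^sub>F h in at 0. norm ((q h - q 0) / h) \<le> \<bar>h\<bar>"
          by (intro always_eventually allI) (auto simp: q_def max_def power2_eq_square)
        show "((\<lambda>h. \<bar>h\<bar>) \<longlongrightarrow> 0) (at (0::real))"
          by (auto intro!: tendsto_eq_intros)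
      qed
      then show ?thesis using 2 by (simp add: DERIV_def)
    next
      case 3
      have "((\<lambda>u. u\<^sup>2) has_real_derivative 2 * u) (at u)"
        by (auto intro!: derivative_eq_intros)
      then have "(q has_real_derivative 2 * u) (at u)"
        by (rule has_field_derivative_transform_within_open[of _ _ _ "{0<..}"]) (use 3 in \<open>auto simp: q_def\<close>)
      then show ?thesis using 3 by simp
    qed
  qed
  have contq: "continuous_on UNIV q" unfolding q_def by (intro continuous_intros)
  define D where "D u = q u + q (1 - u)" for u
  have D: "D u \<noteq> 0" for u
    by (cases "0 < u") (auto simp: D_def q_def max_def add_nonneg_eq_0_iff)
  define D' where "D' u = 2 * max 0 u - 2 * max 0 (1 - u)" for u :: real
  have D_deriv: "(D has_real_derivative D' u) (at u)" for u
    unfolding D_def D'_def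
    by (rule derivative_eq_intros q DERIV_chain2[where f = q] refl)+ simp
  define \<beta> where "\<beta> u = q u / D u" for u
  define \<beta>' where "\<beta>' u = (2 * max 0 u * D u - q u * D' u) / (D u * D u)" for u
  have "(\<beta> has_real_derivative \<beta>' u) (at u)" for u
    unfolding \<beta>_def \<beta>'_def by (rule DERIV_divide[OF q D_deriv D])
  moreover have "continuous_on UNIV D" "continuous_on UNIV D'"
    unfolding D_def[abs_def] D'_def[abs_def] q_def[abs_def] by (intro continuous_intros)+
  then have "continuous_on UNIV \<beta>'"
    unfolding \<beta>'_def[abs_def] using D contq by (intro continuous_intros) auto
  moreover have "\<forall>u\<le>0. \<beta> u = 0" "\<forall>u\<ge>1. \<beta> u = 1" "\<forall>u. 0 \<le> \<beta> u"
    by (auto simp: \<beta>_def D_def q_def)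
  ultimately show ?thesis by blast
qed

lemma bump_exists:
  fixes p :: "'a::euclidean_space"
  assumes "0 < r"
  shows "\<exists>b :: 'a \<Rightarrow> real. C1_on UNIV b \<and> (\<forall>x. dist x p \<le> r \<longrightarrow> b x = 1) \<and>
    (\<forall>x. 2 * r \<le> dist x p \<longrightarrow> b x = 0) \<and> (\<forall>x. 0 \<le> b x)"
proof -
  obtain \<beta> \<beta>' :: "real \<Rightarrow> real" where \<beta>: "\<And>u. (\<beta> has_real_derivative \<beta>' u) (at u)"
      "continuous_on UNIV \<beta>'" "\<And>u. u \<le> 0 \<Longrightarrow> \<beta> u = 0" "\<And>u. 1 \<le> u \<Longrightarrow> \<beta> u = 1" "\<And>u. 0 \<le> \<beta> u"
    using smooth_step_exists by blast
  \<comment> \<open>The squared distance keeps \<open>w\<close> smooth at \<open>p\<close>. It gives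
    \<open>w x \<ge> 1\<close> for distance at most \<open>r\<close>, and
    \<open>w x \<le> -2\<close> for distance at least \<open>2 * r\<close>.\<close>
  define w where "w x = 2 - ((x - p) \<bullet> (x - p)) / r\<^sup>2" for x
  define b where "b x = \<beta> (w x)" for x
  have w: "w x = 2 - (dist x p / r)\<^sup>2" for x
    by (simp add: w_def dist_norm power2_norm_eq_inner power_divide)
  have "C1_on UNIV b"
  proof (rule C1_onI)
    fix x h
    have "(w has_derivative (\<lambda>h. - (2 * ((x - p) \<bullet> h) / r\<^sup>2))) (at x)"
      unfolding w_def using assms
      by (auto intro!: derivative_eq_intros simp: inner_commute inner_diff_left inner_diff_right field_simps)
    from has_derivative_compose[OF this \<beta>(1)[unfolded has_field_derivative_def]]
    show "(b has_derivative (\<lambda>h. \<beta>' (w x) * (- (2 * ((x - p) \<bullet> h) / r\<^sup>2)))) (at x)"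
      by (simp add: b_def[abs_def])
    have "continuous_on UNIV w"
      unfolding w_def[abs_def] using assms by (intro continuous_intros) auto
    from continuous_on_compose2[OF \<beta>(2) this] have "continuous_on UNIV (\<lambda>x. \<beta>' (w x))" by simp
    then show "continuous_on UNIV (\<lambda>x. \<beta>' (w x) * (- (2 * ((x - p) \<bullet> h) / r\<^sup>2)))"
      using assms by (intro continuous_intros) auto
  qed
  moreover have "b x = 1" if "dist x p \<le> r" for x
  proof -
    have "(dist x p / r)\<^sup>2 \<le> 1" using that assms by (simp add: power_le_one)
    then show ?thesis unfolding b_def w by (intro \<beta>) simp
  qed
  moreover have "b x = 0" if "2 * r \<le> dist x p" for x
  proof -
    have "2\<^sup>2 \<le> (dist x p / r)\<^sup>2" using that assms by (intro power_mono) (auto simp: field_simps)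
    then show ?thesis unfolding b_def w by (intro \<beta>) simp
  qed
  ultimately show ?thesis using \<beta>(5) by (intro exI[of _ b]) (auto simp: b_def)
qed

text \<open>The derivative is bounded on a compact ball by continuity and vanishes on its open
  complement. This supplies the global bound demanded by \<open>bounded_C1_field\<close>.\<close>

lemma bounded_derivative_of_eventually_constant:
  fixes g :: "'a::euclidean_space \<Rightarrow> 'b::real_normed_vector"
  assumes g: "\<And>x. (g has_derivative blinfun_apply (g' x)) (at x)" "continuous_on UNIV g'"
    and const: "\<And>x. R < dist x p \<Longrightarrow> g x = c"
  shows "\<exists>K. \<forall>x. norm (g' x) \<le> K"
proof -
  have "bounded (g' ` cball p R)"
    by (intro compact_imp_bounded compact_continuous_image continuous_on_subset[OF g(2)]) auto
  then obtain K where K: "\<And>x. x \<in> cball p R \<Longrightarrow> norm (g' x) \<le> K"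
    unfolding bounded_iff by blast
  have "g' x = 0" if "x \<notin> cball p R" for x
  proof -
    have "((\<lambda>_. c) has_derivative (\<lambda>_. 0)) (at x)" by simp
    then have "(g has_derivative (\<lambda>_. 0)) (at x)"
      by (rule has_derivative_transform_within_open[of _ _ _ _ "- cball p R"])
        (use that const in \<open>auto simp: dist_commute\<close>)
    from has_derivative_unique[OF g(1) this] show ?thesis
      by (auto intro: blinfun_eqI)
  qed
  then have "norm (g' x) \<le> max K 0" for x
    using K[of x] by (cases "x \<in> cball p R") auto
  then show ?thesis by blast
qed

lemma bounded_C1_field_skew_product:
  fixes g :: "'a::euclidean_space \<Rightarrow> 'a" and \<psi> :: "'a \<Rightarrow> real"
  assumes "C1_on UNIV g" "C1_on UNIV \<psi>"
    and const: "\<And>x. R < dist x p \<Longrightarrow> g x = c" "\<And>x. R < dist x p \<Longrightarrow> \<psi> x = d"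
  shows "\<exists>F' K. bounded_C1_field (\<lambda>z. (g (fst z), \<psi> (fst z))) F' K"
proof -
  obtain g' \<psi>' where g': "\<And>x. (g has_derivative blinfun_apply (g' x)) (at x)" "continuous_on UNIV g'"
    and \<psi>': "\<And>x. (\<psi> has_derivative blinfun_apply (\<psi>' x)) (at x)" "continuous_on UNIV \<psi>'"
    using assms(1,2) unfolding C1_on_def by blast
  obtain K1 K2 where K: "\<And>x. norm (g' x) \<le> K1" "\<And>x. norm (\<psi>' x) \<le> K2"
    using bounded_derivative_of_eventually_constant[OF g' const(1)]
      bounded_derivative_of_eventually_constant[OF \<psi>' const(2)] by blast
  have K_pos: "0 \<le> K1" "0 \<le> K2"
    using order_trans[OF norm_ge_zero K(1)] order_trans[OF norm_ge_zero K(2)] by auto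
  define A where "A z h = (g' (fst z) (fst h), \<psi>' (fst z) (fst h))" for z h :: "'a \<times> real"
  have A: "bounded_linear (A z)" for z
    unfolding A_def
    by (intro bounded_linear_Pair bounded_linear_compose[OF blinfun.bounded_linear_right] bounded_linear_fst)
  note A_apply = bounded_linear_Blinfun_apply[OF A]
  have "bounded_C1_field (\<lambda>z. (g (fst z), \<psi> (fst z))) (\<lambda>z. Blinfun (A z)) (K1 + K2)"
  proof
    fix z :: "'a \<times> real"
    have "((\<lambda>z. g (fst z)) has_derivative (\<lambda>h. g' (fst z) (fst h))) (at z)"
      by (rule has_derivative_compose[OF _ g'(1)]) (auto intro!: derivative_eq_intros)
    moreover have "((\<lambda>z. \<psi> (fst z)) has_derivative (\<lambda>h. \<psi>' (fst z) (fst h))) (at z)"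
      by (rule has_derivative_compose[OF _ \<psi>'(1)]) (auto intro!: derivative_eq_intros)
    ultimately show "((\<lambda>z. (g (fst z), \<psi> (fst z))) has_derivative blinfun_apply (Blinfun (A z))) (at z)"
      unfolding A_apply unfolding A_def by (rule has_derivative_Pair)
    show "norm (Blinfun (A z)) \<le> K1 + K2"
    proof (rule norm_blinfun_bound)
      fix h :: "'a \<times> real"
      have "norm (A z h) \<le> norm (g' (fst z) (fst h)) + norm (\<psi>' (fst z) (fst h))"
        unfolding A_def by (rule norm_Pair_le)
      also have "\<dots> \<le> K1 * norm (fst h) + K2 * norm (fst h)"
        using K by (intro add_mono) (meson norm_blinfun mult_right_mono norm_ge_zero order_trans)+
      also have "\<dots> \<le> (K1 + K2) * norm h"
        using K_pos norm_fst_le[of "fst h" "snd h"]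
        by (simp add: distrib_right[symmetric] mult_left_mono)
      finally show "norm (blinfun_apply (Blinfun (A z)) h) \<le> (K1 + K2) * norm h"
        unfolding A_apply .
    qed (use K_pos in auto)
  next
    have 1: "continuous_on UNIV (\<lambda>z :: 'a \<times> real. g' (fst z))"
      by (rule continuous_on_compose2[OF g'(2)]) (auto intro!: continuous_intros)
    have 2: "continuous_on UNIV (\<lambda>z :: 'a \<times> real. \<psi>' (fst z))"
      by (rule continuous_on_compose2[OF \<psi>'(2)]) (auto intro!: continuous_intros)
    show "continuous_on UNIV (\<lambda>z. Blinfun (A z))"
      by (rule continuous_on_blinfun_componentwise) (auto simp: A_apply A_def intro!: continuous_intros 1 2)
  qed
  then show ?thesis by blast
qed

section \<open>Clocks along an attracting flow\<close>

text \<open>The second coordinate of the skew product integrates \<open>\<psi>\<close> along the trajectories of \<open>g\<close>, so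
  that this integral is a C1 function of the initial point because time maps of flows are.\<close>

locale clocked_field = bounded_C1_field "\<lambda>z. (g (fst z), \<psi> (fst z))" F' K
  for g :: "'a::euclidean_space \<Rightarrow> 'a" and \<psi> :: "'a \<Rightarrow> real" and F' K
begin

definition \<phi> :: "real \<Rightarrow> 'a \<Rightarrow> 'a" where "\<phi> t x = fst (flow t (x, 0))"

definition clock :: "real \<Rightarrow> 'a \<Rightarrow> real" where "clock t x = snd (flow t (x, 0))"

text \<open>The field is constant along the second coordinate, so translating a solution in that
  direction gives a solution; uniqueness does the rest.\<close>

lemma flow_eq: "flow t (x, s) = (\<phi> t x, s + clock t x)"
proof -
  have "(\<lambda>t. flow t (x, 0) + (0, s)) t = flow t (flow 0 (x, 0) + (0, s))"
    by (rule flow_unique) (auto intro!: derivative_eq_intros flow_deriv)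
  then show ?thesis by (simp add: \<phi>_def clock_def prod_eq_iff)
qed

lemma \<phi>_0 [simp]: "\<phi> 0 x = x" and clock_0 [simp]: "clock 0 x = 0"
  by (simp_all add: \<phi>_def clock_def)

lemma \<phi>_deriv: "((\<lambda>t. \<phi> t x) has_vector_derivative g (\<phi> t x)) (at t)"
  and clock_deriv: "((\<lambda>t. clock t x) has_real_derivative \<psi> (\<phi> t x)) (at t)"
  using bounded_linear.has_vector_derivative[OF bounded_linear_fst flow_deriv[of "(x, 0)" t]]
    bounded_linear.has_vector_derivative[OF bounded_linear_snd flow_deriv[of "(x, 0)" t]]
  by (simp_all add: \<phi>_def clock_def has_real_derivative_iff_has_vector_derivative)

lemma \<phi>_add: "\<phi> (s + t) x = \<phi> s (\<phi> t x)"
  and clock_add: "clock (s + t) x = clock t x + clock s (\<phi> t x)"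
proof -
  have "flow (s + t) (x, 0) = flow s (\<phi> t x, clock t x)"
    unfolding flow_add by (simp add: \<phi>_def clock_def)
  then show "\<phi> (s + t) x = \<phi> s (\<phi> t x)" "clock (s + t) x = clock t x + clock s (\<phi> t x)"
    by (simp_all add: flow_eq)
qed

lemma \<phi>_minus [simp]: "\<phi> (- t) (\<phi> t x) = x" "\<phi> t (\<phi> (- t) x) = x"
  using \<phi>_add[of "- t" t x] \<phi>_add[of t "- t" x] by simp_all

lemma \<phi>_expansion: "dist (\<phi> t x) (\<phi> t y) \<le> exp ((2 * K + 1) * \<bar>t\<bar> / 2) * dist x y"
proof -
  have "norm (\<phi> t x - \<phi> t y) \<le> norm (flow t (x, 0) - flow t (y, 0))"
    by (simp add: flow_eq norm_fst_le)
  also have "\<dots> \<le> exp ((2 * K + 1) * \<bar>t\<bar> / 2) * norm ((x, 0 :: real) - (y, 0))"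
    by (rule flow_expansion)
  also have "norm ((x, 0 :: real) - (y, 0)) = dist x y"
    by (simp add: norm_Pair dist_norm)
  finally show ?thesis by (simp add: dist_norm)
qed

lemma continuous_\<phi>: "continuous_on S (\<phi> t)"
proof -
  define M where "M = exp ((2 * K + 1) * \<bar>t\<bar> / 2)"
  have "M-lipschitz_on S (\<phi> t)"
    using \<phi>_expansion by (intro lipschitz_onI) (auto simp: M_def)
  then show ?thesis by (rule lipschitz_on_continuous_on)
qed

lemma g_lipschitz: "norm (g x - g y) \<le> K * norm (x - y)"
proof -
  have "norm (g x - g y) \<le> norm ((g x, \<psi> x) - (g y, \<psi> y))"
    by (simp add: norm_fst_le)
  also have "\<dots> \<le> K * norm ((x, 0 :: real) - (y, 0))"
    using F_lipschitz[of "(x, 0)" "(y, 0)"] by simp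
  finally show ?thesis by (simp add: norm_Pair)
qed

text \<open>The one-sided form fits solutions on \<open>{0..}\<close>, whose derivative at time 0 is
  only a derivative from the right.\<close>

lemma \<phi>_unique_forward:
  assumes "\<And>s. s \<in> {0..t} \<Longrightarrow> (y has_vector_derivative g (y s)) (at s within {0..t})" "0 \<le> t"
  shows "y t = \<phi> t (y 0)"
proof -
  have "(norm (y t - \<phi> t (y 0)))\<^sup>2 \<le> exp ((2 * K + 1) * t) * ((norm (y 0 - \<phi> 0 (y 0)))\<^sup>2 + 0\<^sup>2)"
    by (rule norm_growth_forward[where r' = "\<lambda>s. g (y s) - g (\<phi> s (y 0))"])
      (auto intro!: derivative_eq_intros assms has_vector_derivative_at_within[OF \<phi>_deriv]
        simp: g_lipschitz K_nonneg)
  then show ?thesis by simp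
qed

lemma \<phi>_unique:
  assumes "\<And>s. \<bar>s\<bar> \<le> \<bar>t\<bar> \<Longrightarrow> (y has_vector_derivative g (y s)) (at s)"
  shows "y t = \<phi> t (y 0)"
proof -
  have "(norm (y t - \<phi> t (y 0)))\<^sup>2 \<le> exp ((2 * K + 1) * \<bar>t\<bar>) * ((norm (y 0 - \<phi> 0 (y 0)))\<^sup>2 + 0\<^sup>2)"
    by (rule norm_growth[where r' = "\<lambda>s. g (y s) - g (\<phi> s (y 0))"])
      (auto intro!: derivative_eq_intros assms \<phi>_deriv simp: g_lipschitz K_nonneg)
  then show ?thesis by simp
qed

lemma clock_has_derivative:
  "(clock t has_derivative (\<lambda>h. snd (variation (x, 0) (h, 0) t))) (at x)"
proof -
  have "((\<lambda>x. (x, 0)) has_derivative (\<lambda>h. (h, 0))) (at x)"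
    by (auto intro!: derivative_eq_intros)
  from has_derivative_snd[OF has_derivative_compose[OF this flow_has_derivative]]
  show ?thesis by (simp add: clock_def[abs_def])
qed

lemma continuous_clock_derivative: "continuous_on S (\<lambda>x. snd (variation (x, 0) (h, 0) t))"
  by (intro continuous_on_snd continuous_on_compose2[OF continuous_variation[of UNIV]])
    (auto intro!: continuous_intros)

end

text \<open>Stability and attraction are stated for the complete flow \<open>\<phi>\<close>. The
  condition \<open>2 * r < \<rho>\<close> makes \<open>cball p (2 * r)\<close>, outside of which
  \<open>\<psi>\<close> is 1, a compact part of the basin.\<close>

locale attracting_field = clocked_field g \<psi> F' K
  for g :: "'a::euclidean_space \<Rightarrow> 'a" and \<psi> :: "'a \<Rightarrow> real" and F' K +
  fixes p :: 'a and r \<rho> :: real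
  assumes g_p: "g p = 0"
    and stable: "\<And>\<epsilon>. 0 < \<epsilon> \<Longrightarrow> \<exists>\<delta>>0. \<forall>x. dist x p < \<delta> \<longrightarrow> (\<forall>t\<ge>0. dist (\<phi> t x) p < \<epsilon>)"
    and attract: "\<And>x. dist x p < \<rho> \<Longrightarrow> ((\<lambda>t. \<phi> t x) \<longlongrightarrow> p) at_top"
    and r: "0 < r" "2 * r < \<rho>"
    and \<psi>_inner: "\<And>x. dist x p \<le> r \<Longrightarrow> \<psi> x = 0"
    and \<psi>_outer: "\<And>x. 2 * r \<le> dist x p \<Longrightarrow> \<psi> x = 1"
    and \<psi>_le: "\<And>x. \<psi> x \<le> 1"
begin

definition basin :: "'a set" where "basin = {x. ((\<lambda>t. \<phi> t x) \<longlongrightarrow> p) at_top}"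

lemma \<phi>_p [simp]: "\<phi> t p = p"
  using \<phi>_unique[of t "\<lambda>_. p"] by (simp add: g_p)

lemma \<phi>_eq_p_iff [simp]: "\<phi> t x = p \<longleftrightarrow> x = p"
  by (metis \<phi>_minus(1) \<phi>_p)

lemma ball_subset_basin: "ball p \<rho> \<subseteq> basin"
  using attract by (auto simp: basin_def dist_commute)

section \<open>Uniform attraction forwards and escape backwards\<close>

text \<open>By stability an orbit that has entered the \<open>\<delta>\<close>-ball stays within
  \<open>\<epsilon>\<close> of \<open>p\<close> from then on. The entry time \<open>t0\<close> of
  \<open>x\<close> also serves for nearby points, because the single map \<open>\<phi> t0\<close> is
  continuous.\<close>

lemma locally_uniform_attraction:
  assumes "x \<in> basin" "0 < \<epsilon>"
  shows "\<exists>V t0. open V \<and> x \<in> V \<and> 0 \<le> t0 \<and> (\<forall>y\<in>V. \<forall>t\<ge>t0. dist (\<phi> t y) p < \<epsilon>)"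
proof -
  obtain \<delta> where "0 < \<delta>" and \<delta>: "\<And>x t. dist x p < \<delta> \<Longrightarrow> 0 \<le> t \<Longrightarrow> dist (\<phi> t x) p < \<epsilon>"
    using stable[OF \<open>0 < \<epsilon>\<close>] by blast
  have "\<forall>\<^sub>F t in at_top. dist (\<phi> t x) p < \<delta>"
    using assms(1) \<open>0 < \<delta>\<close> unfolding basin_def by (auto dest: tendstoD)
  then obtain N where N: "\<And>t. N \<le> t \<Longrightarrow> dist (\<phi> t x) p < \<delta>"
    by (auto simp: eventually_at_top_linorder)
  define t0 where "t0 = max 0 N"
  define V where "V = \<phi> t0 -` ball p \<delta>"
  have "open V"
    unfolding V_def by (intro open_vimage continuous_\<phi>) auto
  moreover have "x \<in> V" using N[of t0] by (auto simp: V_def t0_def dist_commute)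
  moreover have "dist (\<phi> t y) p < \<epsilon>" if "y \<in> V" "t0 \<le> t" for y t
    using \<delta>[of "\<phi> t0 y" "t - t0"] that \<phi>_add[of "t - t0" t0 y] by (auto simp: V_def dist_commute)
  ultimately show ?thesis by (intro exI[of _ V] exI[of _ t0]) (auto simp: t0_def)
qed

lemma compact_uniform_attraction:
  assumes "compact C" "C \<subseteq> basin" "0 < \<epsilon>"
  shows "\<exists>t0\<ge>0. \<forall>y\<in>C. \<forall>t\<ge>t0. dist (\<phi> t y) p < \<epsilon>"
proof -
  obtain V T where V: "\<And>x. x \<in> C \<Longrightarrow> open (V x) \<and> x \<in> V x \<and> (\<forall>y\<in>V x. \<forall>t\<ge>T x. dist (\<phi> t y) p < \<epsilon>)"
    using locally_uniform_attraction[OF _ assms(3)] assms(2) by (metis subsetD)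
  obtain D where D: "D \<subseteq> C" "finite D" "C \<subseteq> (\<Union>x\<in>D. V x)"
    by (rule compactE_image[OF assms(1), of C V]) (use V in auto)
  \<comment> \<open>Inserting 0 keeps the maximum meaningful for empty \<open>D\<close> and makes
    \<open>t0\<close> nonnegative.\<close>
  define t0 where "t0 = Max (insert 0 (T ` D))"
  have t0: "0 \<le> t0" "\<And>x. x \<in> D \<Longrightarrow> T x \<le> t0"
    using D(2) by (auto simp: t0_def)
  have "dist (\<phi> t y) p < \<epsilon>" if y: "y \<in> C" and t: "t0 \<le> t" for y t
  proof -
    obtain x where "x \<in> D" "y \<in> V x" using D y by auto
    then show ?thesis using V D(1) t0(2) t by (meson order_trans subsetD)
  qed
  then show ?thesis using t0 by blast
qed

text \<open>If \<open>\<phi> (- t) y\<close> were still in the compact ball of radius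
  \<open>2 * r\<close>, uniform attraction over time \<open>t\<close> would bring \<open>y\<close>
  within \<open>\<epsilon>\<close> of \<open>p\<close>; but \<open>y\<close> is within
  \<open>\<epsilon>\<close> of \<open>x\<close>, and \<open>\<epsilon>\<close> is half the distance
  from \<open>x\<close> to \<open>p\<close>.\<close>

lemma locally_uniform_escape:
  assumes "x \<noteq> p"
  shows "\<exists>V t0. open V \<and> x \<in> V \<and> 0 \<le> t0 \<and> (\<forall>y\<in>V. \<forall>t\<ge>t0. 2 * r < dist (\<phi> (- t) y) p)"
proof -
  define \<epsilon> where "\<epsilon> = dist x p / 2"
  have "0 < \<epsilon>" using assms by (simp add: \<epsilon>_def)
  have "cball p (2 * r) \<subseteq> basin"
    using ball_subset_basin r(2) by (auto simp: subset_iff)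
  then obtain t0 where t0: "0 \<le> t0" "\<And>y t. dist y p \<le> 2 * r \<Longrightarrow> t0 \<le> t \<Longrightarrow> dist (\<phi> t y) p < \<epsilon>"
    using compact_uniform_attraction[of "cball p (2 * r)" \<epsilon>] \<open>0 < \<epsilon>\<close> by (auto simp: dist_commute)
  have "2 * r < dist (\<phi> (- t) y) p" if y: "y \<in> ball x \<epsilon>" and t: "t0 \<le> t" for y t
  proof (rule ccontr)
    assume "\<not> 2 * r < dist (\<phi> (- t) y) p"
    then have "dist y p < \<epsilon>" using t0(2)[of "\<phi> (- t) y" t] t by simp
    then have "dist x p < 2 * \<epsilon>" using y dist_triangle[of x p y] by simp
    then show False by (simp add: \<epsilon>_def)
  qed
  then show ?thesis
    using \<open>0 < \<epsilon>\<close> t0(1) by (intro exI[of _ "ball x \<epsilon>"] exI[of _ t0]) auto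
qed

text \<open>The clock runs at speed \<open>\<psi>\<close>, which along the orbit is 0 at late and 1
  at early times. One threshold \<open>t0\<close> serves a whole neighbourhood by uniform attraction
  and escape.\<close>

lemma clock_eventually_affine:
  assumes "x \<in> basin" "x \<noteq> p"
  shows "\<exists>V t0. open V \<and> x \<in> V \<and> 0 \<le> t0 \<and>
    (\<forall>y\<in>V. \<forall>t\<ge>t0. clock t y = clock t0 y \<and> clock (- t) y + t = clock (- t0) y + t0)"
proof -
  obtain V t1 where V: "open V" "x \<in> V" "0 \<le> t1" "\<And>y t. y \<in> V \<Longrightarrow> t1 \<le> t \<Longrightarrow> dist (\<phi> t y) p < r"
    using locally_uniform_attraction[OF assms(1) r(1)] by metis
  obtain W t2 where W: "open W" "x \<in> W" "0 \<le> t2"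
      "\<And>y t. y \<in> W \<Longrightarrow> t2 \<le> t \<Longrightarrow> 2 * r < dist (\<phi> (- t) y) p"
    using locally_uniform_escape[OF assms(2)] by metis
  define t0 where "t0 = max t1 t2"
  have "clock t y = clock t0 y \<and> clock (- t) y + t = clock (- t0) y + t0"
    if y: "y \<in> V \<inter> W" and t: "t0 \<le> t" for y t
  proof (cases "t = t0")
    case False
    then have t: "t0 < t" using t by simp
    have 1: "((\<lambda>t. clock t y) has_real_derivative 0) (at s)" if "t0 \<le> s" for s
      using clock_deriv[of y s] \<psi>_inner[of "\<phi> s y"] V(4)[of y s] y that by (simp add: t0_def)
    have 2: "((\<lambda>t. clock (- t) y + t) has_real_derivative 0) (at s)" if "t0 \<le> s" for s
    proof -
      have "((\<lambda>t. clock (- t) y) has_real_derivative \<psi> (\<phi> (- s) y) * (- 1)) (at s)"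
        by (rule DERIV_chain2[OF clock_deriv]) (auto intro!: derivative_eq_intros)
      moreover have "\<psi> (\<phi> (- s) y) = 1"
        using \<psi>_outer[of "\<phi> (- s) y"] W(4)[of y s] y that by (simp add: t0_def)
      ultimately show ?thesis by (auto intro!: derivative_eq_intros)
    qed
    have const: "h t = h t0" if "\<And>s. t0 \<le> s \<Longrightarrow> (h has_real_derivative 0) (at s)" for h :: "real \<Rightarrow> real"
    proof (rule DERIV_isconst2[OF t])
      show "continuous_on {t0..t} h"
        by (intro continuous_at_imp_continuous_on ballI DERIV_isCont[OF that]) simp
    qed (use t that in auto)
    from const[OF 1] const[OF 2] show ?thesis by simp
  qed auto
  moreover have "open (V \<inter> W)" "x \<in> V \<inter> W" "0 \<le> t0"
    using V W by (auto simp: t0_def)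
  ultimately show ?thesis by blast
qed

text \<open>Formally \<open>phase x\<close> is the integral of \<open>1 - \<psi>\<close> over the past of \<open>x\<close> minus the integral of \<open>\<psi>\<close>
  over its future; both integrands vanish for large times.\<close>

definition phase :: "'a \<Rightarrow> real" where
  "phase x = Lim at_top (\<lambda>t. t + clock (- t) x - clock t x)"

lemma phase_eqI:
  assumes "\<And>t. t0 \<le> t \<Longrightarrow> t + clock (- t) x - clock t x = c"
  shows "phase x = c"
  unfolding phase_def
proof (rule tendsto_Lim)
  have "\<forall>\<^sub>F t in at_top. t + clock (- t) x - clock t x = c"
    using assms by (auto simp: eventually_at_top_linorder)
  then show "((\<lambda>t. t + clock (- t) x - clock t x) \<longlongrightarrow> c) at_top"
    by (rule tendsto_eventually)
qed simp

text \<open>Near \<open>x\<close> the limit is replaced by clocks at the fixed times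
  \<open>t0\<close> and \<open>- t0\<close>, from which \<open>phase\<close> inherits its
  smoothness.\<close>

lemma phase_locally:
  assumes "x \<in> basin" "x \<noteq> p"
  shows "\<exists>V t0. open V \<and> x \<in> V \<and> 0 \<le> t0 \<and> (\<forall>y\<in>V. phase y = t0 + clock (- t0) y - clock t0 y)"
proof -
  obtain V t0 where V: "open V" "x \<in> V" "0 \<le> t0"
    and c: "\<And>y t. y \<in> V \<Longrightarrow> t0 \<le> t \<Longrightarrow> clock t y = clock t0 y \<and> clock (- t) y + t = clock (- t0) y + t0"
    using clock_eventually_affine[OF assms] by metis
  have "phase y = t0 + clock (- t0) y - clock t0 y" if "y \<in> V" for y
    by (rule phase_eqI[of t0]) (use c[OF that] in \<open>smt (verit)\<close>)
  then show ?thesis using V by blast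
qed

lemma phase_\<phi>:
  assumes "x \<in> basin" "x \<noteq> p"
  shows "phase (\<phi> s x) = phase x + s"
proof -
  obtain t0 where "0 \<le> t0"
    and c: "\<And>t. t0 \<le> t \<Longrightarrow> clock t x = clock t0 x \<and> clock (- t) x + t = clock (- t0) x + t0"
    using clock_eventually_affine[OF assms] by metis
  have "phase x = t0 + clock (- t0) x - clock t0 x"
    by (rule phase_eqI[of t0]) (use c in \<open>smt (verit)\<close>)
  moreover have "phase (\<phi> s x) = t0 + clock (- t0) x - clock t0 x + s"
  proof (rule phase_eqI[of "t0 + \<bar>s\<bar>"])
    fix t assume t: "t0 + \<bar>s\<bar> \<le> t"
    \<comment> \<open>The time window from \<open>- t\<close> to \<open>t\<close> for
      \<open>\<phi> s x\<close> is the window from \<open>s - t\<close> to \<open>s + t\<close> for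
      \<open>x\<close>. The margin \<open>\<bar>s\<bar>\<close> puts both ends in the affine range,
      where the shift of the early end contributes \<open>s\<close> and that of the late end
      nothing.\<close>
    have "clock (- (t - s)) x + (t - s) = clock (- t0) x + t0" "clock (t + s) x = clock t0 x"
      using c[of "t - s"] c[of "t + s"] t by auto
    then show "t + clock (- t) (\<phi> s x) - clock t (\<phi> s x) = t0 + clock (- t0) x - clock t0 x + s"
      using clock_add[of "- t" s x] clock_add[of t s x] by simp
  qed
  ultimately show ?thesis by simp
qed

text \<open>Orbits starting close to \<open>p\<close> spend their whole future in the zone
  \<open>\<psi> = 0\<close>, so only the past contributes, with the nonnegative integrand
  \<open>1 - \<psi>\<close>.\<close>

lemma phase_nonneg_near:
  "\<exists>\<delta>>0. \<delta> \<le> \<rho> \<and> (\<forall>x. dist x p < \<delta> \<longrightarrow> x \<noteq> p \<longrightarrow> 0 \<le> phase x)"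
proof -
  obtain \<delta> where "0 < \<delta>" and \<delta>: "\<And>x t. dist x p < \<delta> \<Longrightarrow> 0 \<le> t \<Longrightarrow> dist (\<phi> t x) p < r"
    using stable[OF r(1)] by blast
  have "0 \<le> phase x" if x: "dist x p < min \<delta> \<rho>" "x \<noteq> p" for x
  proof -
    have "x \<in> basin" using x ball_subset_basin by (auto simp: dist_commute subset_iff)
    then obtain t0 where "0 \<le> t0" and t0: "phase x = t0 + clock (- t0) x - clock t0 x"
      using phase_locally x(2) by metis
    have "clock t0 x \<le> clock 0 x"
    proof (rule DERIV_nonpos_imp_nonincreasing[OF \<open>0 \<le> t0\<close>])
      fix s :: real assume "0 \<le> s"
      then have "\<psi> (\<phi> s x) = 0" using \<psi>_inner[of "\<phi> s x"] \<delta>[of x s] x by simp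
      then show "\<exists>y. ((\<lambda>t. clock t x) has_real_derivative y) (at s) \<and> y \<le> 0"
        using clock_deriv[of x s] by auto
    qed
    moreover have "clock 0 x - 0 \<le> clock (- t0) x - (- t0)"
    proof (rule DERIV_nonpos_imp_nonincreasing[where f = "\<lambda>t. clock t x - t"])
      fix s
      have "((\<lambda>t. clock t x - t) has_real_derivative \<psi> (\<phi> s x) - 1) (at s)"
        by (intro derivative_intros clock_deriv)
      then show "\<exists>y. ((\<lambda>t. clock t x - t) has_real_derivative y) (at s) \<and> y \<le> 0"
        using \<psi>_le[of "\<phi> s x"] by auto
    qed (use \<open>0 \<le> t0\<close> in auto)
    ultimately show ?thesis using t0 by simp
  qed
  then show ?thesis using \<open>0 < \<delta>\<close> r by (intro exI[of _ "min \<delta> \<rho>"]) auto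
qed

section \<open>The Lyapunov function of the flow and its regularity\<close>

definition lyap :: "'a \<Rightarrow> real" where
  "lyap x = (if x = p then 0 else exp (- (2 * K + 1) * phase x))"

lemma lyap_p [simp]: "lyap p = 0" and lyap_pos: "x \<noteq> p \<Longrightarrow> 0 < lyap x"
  by (simp_all add: lyap_def)

lemma lyap_\<phi>: "x \<in> basin \<Longrightarrow> lyap (\<phi> s x) = exp (- (2 * K + 1) * s) * lyap x"
  by (simp add: lyap_def phase_\<phi> exp_add[symmetric] algebra_simps)

text \<open>Near a point other than \<open>p\<close>, \<open>lyap\<close> is the exponential of a
  combination of clocks at fixed times, and these are C1 through the variational equation.\<close>

lemma lyap_C1_on: "C1_on (ball p \<rho> - {p}) lyap"
proof (rule C1_on_local)
  fix x assume "x \<in> ball p \<rho> - {p}"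
  then have "x \<in> basin" "x \<noteq> p" using ball_subset_basin by auto
  then obtain V t0 where V: "open V" "x \<in> V"
    and phase: "\<And>y. y \<in> V \<Longrightarrow> phase y = t0 + clock (- t0) y - clock t0 y"
    using phase_locally by metis
  define T where "T y = t0 + clock (- t0) y - clock t0 y" for y
  define T' where "T' y h = snd (variation (y, 0) (h, 0) (- t0)) - snd (variation (y, 0) (h, 0) t0)" for y h
  have T: "(T has_derivative T' y) (at y)" for y
    unfolding T_def T'_def
    by (rule derivative_eq_intros clock_has_derivative refl)+ (simp add: fun_eq_iff)
  define L' where "L' y h = exp (- (2 * K + 1) * T y) * (- (2 * K + 1) * T' y h)" for y h
  have "C1_on (V - {p}) lyap"
  proof (rule C1_onI)
    fix y assume y: "y \<in> V - {p}"
    have "((\<lambda>y. exp (- (2 * K + 1) * T y)) has_derivative L' y) (at y)"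
      unfolding L'_def by (rule derivative_eq_intros T refl)+ (simp add: fun_eq_iff)
    then show "(lyap has_derivative L' y) (at y)"
      by (rule has_derivative_transform_within_open[of _ _ _ _ "V - {p}"])
        (use V(1) y phase in \<open>auto simp: lyap_def T_def\<close>)
  next
    fix h
    have "continuous_on (V - {p}) T"
      using T has_derivative_continuous by (blast intro: continuous_at_imp_continuous_on)
    moreover have "continuous_on (V - {p}) (\<lambda>y. T' y h)"
      unfolding T'_def by (intro continuous_intros continuous_clock_derivative)
    ultimately show "continuous_on (V - {p}) (\<lambda>y. L' y h)"
      unfolding L'_def by (intro continuous_intros)
  qed
  then show "\<exists>V. open V \<and> x \<in> V \<and> C1_on V lyap"
    using V \<open>x \<noteq> p\<close> by (intro exI[of _ "V - {p}"]) auto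
qed

text \<open>Backward orbits move away from \<open>p\<close> at most at the rate \<open>K + 1/2\<close>, so they stay near \<open>p\<close> for a
  time at least logarithmic in the distance to \<open>p\<close>; the decay rate \<open>2 * K + 1\<close> of \<open>lyap\<close> is chosen
  to turn this into a quadratic bound.\<close>

lemma lyap_quadratic:
  "\<exists>\<delta>>0. \<forall>x. dist x p < \<delta> / 2 \<longrightarrow> lyap x \<le> (2 * dist x p / \<delta>)\<^sup>2"
proof -
  obtain \<delta> where "0 < \<delta>" "\<delta> \<le> \<rho>" and nonneg: "\<And>x. dist x p < \<delta> \<Longrightarrow> x \<noteq> p \<Longrightarrow> 0 \<le> phase x"
    using phase_nonneg_near by blast
  have "lyap x \<le> (2 * dist x p / \<delta>)\<^sup>2" if x: "dist x p < \<delta> / 2" for x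
  proof (cases "x = p")
    case False
    define c where "c = (2 * K + 1) / 2"
    have "0 < c" using K_nonneg by (simp add: c_def)
    define q where "q = 2 * dist x p / \<delta>"
    have q: "0 < q" "q < 1" using False x \<open>0 < \<delta>\<close> by (auto simp: q_def field_simps)
    \<comment> \<open>Going back for time \<open>s\<close> can enlarge the distance to
      \<open>p\<close> to at most \<open>\<delta> / 2\<close>, still inside the ball where
      \<open>phase\<close> is nonnegative; hence \<open>phase x \<ge> s\<close>.\<close>
    define s where "s = - ln q / c"
    have "0 \<le> s" using q \<open>0 < c\<close> by (auto simp: s_def field_simps)
    have exp_s: "exp (c * s) = 1 / q"
      using q \<open>0 < c\<close> by (simp add: s_def exp_minus inverse_eq_divide)
    have basin: "x \<in> basin"
      using x \<open>0 < \<delta>\<close> \<open>\<delta> \<le> \<rho>\<close> ball_subset_basin by (auto simp: dist_commute subset_iff)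
    have "dist (\<phi> (- s) x) p \<le> exp (c * s) * dist x p"
      using \<phi>_expansion[of "- s" x p] \<open>0 \<le> s\<close> by (simp add: c_def)
    also have "\<dots> = \<delta> / 2"
      using exp_s False by (simp add: q_def)
    finally have "0 \<le> phase (\<phi> (- s) x)"
      using \<open>0 < \<delta>\<close> False by (intro nonneg) auto
    then have "s \<le> phase x"
      using phase_\<phi>[OF basin False, of "- s"] by simp
    then have "lyap x \<le> exp (- (2 * K + 1) * s)"
      using False K_nonneg by (simp add: lyap_def mult_left_mono)
    also have "- (2 * K + 1) * s = - (2 * (c * s))" by (simp add: c_def algebra_simps)
    also have "exp (- (2 * (c * s))) = q\<^sup>2"
      using exp_s q by (simp add: exp_minus exp_double power_one_over inverse_eq_divide)
    finally show ?thesis by (simp add: q_def)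
  qed simp
  then show ?thesis using \<open>0 < \<delta>\<close> by blast
qed

text \<open>A nonnegative function with value 0 at \<open>p\<close> and a quadratic upper bound near
  \<open>p\<close> has derivative 0 there; the radius \<open>e * \<delta>\<^sup>2 / 4\<close> turns
  the quadratic bound into \<open>e\<close> times the distance.\<close>

lemma lyap_has_derivative_p: "(lyap has_derivative (\<lambda>_. 0)) (at p)"
  unfolding has_derivative_at_alt
proof (intro conjI bounded_linear_zero allI impI)
  fix e :: real assume "0 < e"
  obtain \<delta> where "0 < \<delta>" and \<delta>: "\<And>x. dist x p < \<delta> / 2 \<Longrightarrow> lyap x \<le> (2 * dist x p / \<delta>)\<^sup>2"
    using lyap_quadratic by blast
  have "norm (lyap y - lyap p - 0) \<le> e * norm (y - p)" if y: "norm (y - p) < min (\<delta> / 2) (e * \<delta>\<^sup>2 / 4)" for y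
  proof -
    have "0 \<le> lyap y" using lyap_pos[of y] by (cases "y = p") auto
    moreover have "lyap y \<le> (2 * norm (y - p) / \<delta>)\<^sup>2"
      using \<delta>[of y] y by (simp add: dist_norm)
    moreover have "\<dots> = (4 * norm (y - p) / \<delta>\<^sup>2) * norm (y - p)"
      by (simp add: power2_eq_square)
    moreover have "\<dots> \<le> e * norm (y - p)"
      using y \<open>0 < \<delta>\<close> by (intro mult_right_mono) (auto simp: field_simps)
    ultimately show ?thesis by simp
  qed
  then show "\<exists>d>0. \<forall>y. norm (y - p) < d \<longrightarrow> norm (lyap y - lyap p - 0) \<le> e * norm (y - p)"
    using \<open>0 < e\<close> \<open>0 < \<delta>\<close> by (intro exI[of _ "min (\<delta> / 2) (e * \<delta>\<^sup>2 / 4)"]) auto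
qed

lemma lyap_differentiable:
  assumes "x \<in> ball p \<rho>"
  shows "lyap differentiable (at x)"
proof (cases "x = p")
  case True
  then show ?thesis using lyap_has_derivative_p unfolding differentiable_def by blast
next
  case False
  then show ?thesis using assms lyap_C1_on unfolding C1_on_def differentiable_def by blast
qed

end

section \<open>The Lyapunov function\<close>

theorem mainTheorem11:
  fixes f :: "real ^ 'n \<Rightarrow> real ^ 'n" and p :: "real ^ 'n"
  assumes "C1_on UNIV f"
    and "asymptotically_stable_equilibrium f p"
  shows "\<exists>U a (L :: real ^ 'n \<Rightarrow> real). open U \<and> p \<in> U \<and> a > 0 \<and>
           (\<forall>u\<in>U. L differentiable (at u)) \<and> C1_on (U - {p}) L \<and>
           L p = 0 \<and> (\<forall>u\<in>U. u \<noteq> p \<longrightarrow> L u > 0) \<and>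
           orbital_derivative_on f U L (\<lambda>u. - a * L u)"
proof -
  have fp: "f p = 0"
    and stable: "\<And>\<epsilon>. 0 < \<epsilon> \<Longrightarrow> \<exists>\<delta>>0. \<forall>x0. dist x0 p < \<delta> \<longrightarrow>
      (\<exists>x. is_solution f x {0..} \<and> x 0 = x0) \<and>
      (\<forall>x. is_solution f x {0..} \<and> x 0 = x0 \<longrightarrow> (\<forall>t\<ge>0. dist (x t) p < \<epsilon>))"
    and attractive: "attractive f p"
    using assms(2)
    unfolding asymptotically_stable_equilibrium_def equilibrium_def lyapunov_stable_def by blast+
  \<comment> \<open>Stability with radius 1 confines these solutions to the unit ball around
    \<open>p\<close>, where the cut-off field will coincide with \<open>f\<close>.\<close>
  obtain \<delta>1 where "0 < \<delta>1" and \<delta>1: "\<And>x0. dist x0 p < \<delta>1 \<Longrightarrow> \<exists>x. is_solution f x {0..} \<and> x 0 = x0"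
      "\<And>x t. dist (x 0) p < \<delta>1 \<Longrightarrow> is_solution f x {0..} \<Longrightarrow> 0 \<le> t \<Longrightarrow> dist (x t) p < 1"
    using stable[of 1] by auto
  obtain \<eta> where "0 < \<eta>"
    and \<eta>: "\<And>x. dist (x 0) p < \<eta> \<Longrightarrow> is_solution f x {0..} \<Longrightarrow> (x \<longlongrightarrow> p) at_top"
    using attractive unfolding attractive_def by auto
  \<comment> \<open>\<open>\<delta>1\<close> confines forward solutions to the unit ball,
    \<open>\<eta>\<close> ensures attraction, and 1 puts \<open>ball p \<rho>\<close> inside the
    region where \<open>g = f\<close>.\<close>
  define \<rho> where "\<rho> = min (min \<delta>1 \<eta>) 1"
  have \<rho>: "0 < \<rho>" "\<rho> \<le> \<delta>1" "\<rho> \<le> \<eta>" "\<rho> \<le> 1" using \<open>0 < \<delta>1\<close> \<open>0 < \<eta>\<close> by (auto simp: \<rho>_def)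

  obtain b :: "real ^ 'n \<Rightarrow> real" where b: "C1_on UNIV b" "\<And>x. dist x p \<le> 1 \<Longrightarrow> b x = 1"
      "\<And>x. 2 \<le> dist x p \<Longrightarrow> b x = 0"
    using bump_exists[of 1 p] by auto
  define r where "r = \<rho> / 4"
  have r: "0 < r" "2 * r < \<rho>" "2 * r \<le> 2" using \<rho> by (auto simp: r_def)
  obtain c :: "real ^ 'n \<Rightarrow> real" where c: "C1_on UNIV c" "\<And>x. dist x p \<le> r \<Longrightarrow> c x = 1"
      "\<And>x. 2 * r \<le> dist x p \<Longrightarrow> c x = 0" "\<And>x. 0 \<le> c x"
    using bump_exists[OF r(1), of p] by auto
  define g where "g x = b x *\<^sub>R f x" for x
  define \<psi> where "\<psi> x = 1 - c x" for x
  have g_eq: "g x = f x" if "dist x p \<le> 1" for x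
    using b(2)[OF that] by (simp add: g_def)

  have "C1_on UNIV g"
  proof -
    obtain b' f' where b': "\<And>x. (b has_derivative blinfun_apply (b' x)) (at x)" "continuous_on UNIV b'"
      and f': "\<And>x. (f has_derivative blinfun_apply (f' x)) (at x)" "continuous_on UNIV f'"
      using b(1) assms(1) unfolding C1_on_def by blast
    have "continuous_on UNIV b" "continuous_on UNIV f"
      using b'(1) f'(1) has_derivative_continuous by (blast intro: continuous_at_imp_continuous_on)+
    then have "continuous_on UNIV (\<lambda>x. b x *\<^sub>R f' x h + b' x h *\<^sub>R f x)" for h
      using b'(2) f'(2) by (intro continuous_intros)
    then show ?thesis
      by (rule C1_onI[rotated]) (unfold g_def, rule has_derivative_scaleR[OF b'(1) f'(1)])
  qed
  moreover have "C1_on UNIV \<psi>"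
  proof -
    obtain c' where c': "\<And>x. (c has_derivative blinfun_apply (c' x)) (at x)" "continuous_on UNIV c'"
      using c(1) unfolding C1_on_def by blast
    have "(\<psi> has_derivative (\<lambda>h. - c' x h)) (at x)" for x
      unfolding \<psi>_def by (auto intro!: derivative_eq_intros c'(1))
    then show ?thesis
      by (rule C1_onI) (use c'(2) in \<open>auto intro!: continuous_intros\<close>)
  qed
  moreover have "g x = 0" "\<psi> x = 1" if "2 < dist x p" for x
    using that b(3)[of x] c(3)[of x] r(3) by (auto simp: g_def \<psi>_def)
  ultimately obtain F' K where "bounded_C1_field (\<lambda>z. (g (fst z), \<psi> (fst z))) F' K"
    using bounded_C1_field_skew_product[of g \<psi> 2 p 0 1] by blast
  then interpret clocked_field g \<psi> F' K
    by (simp add: clocked_field_def)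

  \<comment> \<open>This transfers stability and attraction from solutions of \<open>f\<close> to
    \<open>\<phi>\<close>: a confined solution of \<open>f\<close> also solves the equation of
    \<open>g\<close>, so it is an orbit of \<open>\<phi>\<close>.\<close>
  have sol: "\<exists>x. is_solution f x {0..} \<and> x 0 = x0 \<and> (\<forall>t\<ge>0. x t = \<phi> t x0)" if x0: "dist x0 p < \<rho>" for x0
  proof -
    obtain x where x: "is_solution f x {0..}" "x 0 = x0"
      using \<delta>1(1)[of x0] x0 \<rho> by auto
    have "x t = \<phi> t (x 0)" if t: "0 \<le> t" for t
    proof (rule \<phi>_unique_forward)
      fix s assume s: "s \<in> {0..t}"
      have "g (x s) = f (x s)"
        using \<delta>1(2)[OF _ x(1), of s] s x0 x(2) \<rho> by (intro g_eq) auto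
      then show "(x has_vector_derivative g (x s)) (at s within {0..t})"
        using x(1) s unfolding is_solution_def
        by (auto intro: has_vector_derivative_within_subset)
    qed (use t in auto)
    then show ?thesis using x by auto
  qed

  interpret attracting_field g \<psi> F' K p r \<rho>
  proof
    show "g p = 0" using fp by (simp add: g_def)
    show "\<exists>\<delta>>0. \<forall>x. dist x p < \<delta> \<longrightarrow> (\<forall>t\<ge>0. dist (\<phi> t x) p < \<epsilon>)" if "0 < \<epsilon>" for \<epsilon>
    proof -
      obtain \<delta> where "0 < \<delta>"
        and \<delta>: "\<And>x t. dist (x 0) p < \<delta> \<Longrightarrow> is_solution f x {0..} \<Longrightarrow> 0 \<le> t \<Longrightarrow> dist (x t) p < \<epsilon>"
        using stable[OF \<open>0 < \<epsilon>\<close>] by auto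
      have "dist (\<phi> t x0) p < \<epsilon>" if x0: "dist x0 p < min \<delta> \<rho>" "0 \<le> t" for x0 t
      proof -
        obtain x where "is_solution f x {0..}" "x 0 = x0" "x t = \<phi> t x0"
          using sol[of x0] x0 by auto
        then show ?thesis using \<delta>[of x t] x0 by simp
      qed
      then show ?thesis using \<open>0 < \<delta>\<close> \<rho>(1) by (intro exI[of _ "min \<delta> \<rho>"]) auto
    qed
    show "((\<lambda>t. \<phi> t x0) \<longlongrightarrow> p) at_top" if x0: "dist x0 p < \<rho>" for x0
    proof -
      obtain x where x: "is_solution f x {0..}" "x 0 = x0" "\<And>t. 0 \<le> t \<Longrightarrow> x t = \<phi> t x0"
        using sol[OF x0] by blast
      have "(x \<longlongrightarrow> p) at_top" using \<eta>[OF _ x(1)] x(2) x0 \<rho> by simp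
      then show ?thesis
        by (rule Lim_transform_eventually) (rule eventually_mono[OF eventually_ge_at_top[of 0] x(3)])
    qed
  qed (use r c in \<open>auto simp: \<psi>_def\<close>)

  have "orbital_derivative_on f (ball p \<rho>) lyap (\<lambda>u. - (2 * K + 1) * lyap u)"
    unfolding orbital_derivative_on_def
  proof (intro allI impI, elim conjE)
    fix x I t assume sol: "is_solution f x I" and I: "open I" "t \<in> I" and xt: "x t \<in> ball p \<rho>"
    have deriv: "(x has_vector_derivative f (x s)) (at s)" if "s \<in> I" for s
      using sol that I(1) unfolding is_solution_def by (metis at_within_open)
    then have "continuous_on I x"
      by (meson continuous_at_imp_continuous_on has_vector_derivative_continuous)
    then have "open (I \<inter> x -` ball p 1)"
      using I(1) by (simp add: continuous_open_vimage continuous_on_open_vimage Int_commute)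
    moreover have "t \<in> I \<inter> x -` ball p 1" using I xt \<rho> by auto
    ultimately obtain e where "0 < e" and e: "ball t e \<subseteq> I \<inter> x -` ball p 1"
      by (meson open_contains_ball)
    \<comment> \<open>For times within \<open>e\<close> of \<open>t\<close> the solution stays in
      the unit ball and hence solves the equation of \<open>g\<close>; by local uniqueness it is a
      piece of an orbit of \<open>\<phi>\<close>, along which \<open>lyap\<close> is exactly
      exponential.\<close>
    have shift: "x (t + s) = \<phi> s (x t)" if s: "\<bar>s\<bar> < e" for s
    proof -
      have "(\<lambda>s. x (t + s)) s = \<phi> s (x (t + 0))"
      proof (rule \<phi>_unique)
        fix u assume u: "\<bar>u\<bar> \<le> \<bar>s\<bar>"
        then have "t + u \<in> ball t e" using s by (simp add: dist_norm)
        then have *: "t + u \<in> I" "dist (x (t + u)) p \<le> 1"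
          using e by (auto simp: dist_commute subset_iff)
        have "((\<lambda>u. t + u) has_vector_derivative 1) (at u)"
          by (auto intro!: derivative_eq_intros)
        from vector_diff_chain_at[OF this deriv[OF *(1)]]
        show "((\<lambda>s. x (t + s)) has_vector_derivative g (x (t + u))) (at u)"
          by (simp add: o_def g_eq[OF *(2)])
      qed
      then show ?thesis by simp
    qed
    have x: "x s = \<phi> (s - t) (x t)" if "s \<in> ball t e" for s
      using shift[of "s - t"] that by (simp add: dist_norm abs_minus_commute)
    have "x t \<in> basin" using xt ball_subset_basin by blast
    have lyap_x: "exp (- (2 * K + 1) * (s - t)) * lyap (x t) = lyap (x s)" if "s \<in> ball t e" for s
      by (subst x[OF that]) (rule lyap_\<phi>[OF \<open>x t \<in> basin\<close>, symmetric])
    have "((\<lambda>s. exp (- (2 * K + 1) * (s - t)) * lyap (x t)) has_real_derivative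
        - (2 * K + 1) * lyap (x t)) (at t)"
      by (auto intro!: derivative_eq_intros)
    then show "((\<lambda>s. lyap (x s)) has_real_derivative - (2 * K + 1) * lyap (x t)) (at t)"
      by (rule has_field_derivative_transform_within_open[of _ _ _ "ball t e"])
        (use \<open>0 < e\<close> lyap_x in auto)
  qed
  then show ?thesis
    using \<rho>(1) K_nonneg lyap_differentiable lyap_C1_on lyap_pos
    by (intro exI[of _ "ball p \<rho>"] exI[of _ "2 * K + 1"] exI[of _ lyap]) auto
qed

end
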